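(* Assume $\sum_{i=1}^n w_i^s=\sum_{j=1}^m w_j^p$. Let $C=N^{2(n+m)}$ (a positive self-adjoint operator on $\mathscr{H}$) and $C_\epsilon=C(1+\epsilon C)^{-2}$. Then there exist $\delta>0$ and constants $b_1,b_2\ge0$ such that: (0) $\mathrm{Dom}(C^{1/2})\subset\mathrm{Dom}(F):=\bigcap_{i,j=0}^d\mathrm{Dom}(F_{ij})$; (a) for each $\epsilon\in(0,\delta)$, with $D_\epsilon:=D$, one has $C_\epsilon^{1/2}D_\epsilon\subset D$ and each operator $F_{ij}^*C_\epsilon^{1/2}|_{D_\epsilon}$ ($0\le i,j\le d$) is bounded; (b) for all $\epsilon\in(0,\delta)$ and all $u_0,\dots,u_d\in\mathrm{Dom}(F)$, $$\sum_{i,j=0}^d\Big(\langle u_i|C_\epsilon F_{ij}u_j\rangle+\langle F_{ji}u_i|C_\epsilon u_j\rangle+\sum_{k=1}^d\langle F_{ki}u_i|C_\epsilon F_{kj}u_j\rangle\Big)\le\sum_{i=0}^d\Big(b_1\langle u_i|C_\epsilon u_i\rangle+b_2\|u_i\|^2\Big).$$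
   Context: Let $n,m\ge1$, $\mathbb{N}=\{0,1,2,\dots\}$, $\mathscr{H}=\bigotimes_{i=1}^{n+m}\ell^2(\mathbb{N})$ with orthonormal basis $e(\mathsf{s},\mathsf{p})=e_{s_1}\otimes\cdots\otimes e_{s_n}\otimes e_{p_1}\otimes\cdots\otimes e_{p_m}$ ($\mathsf{s}\in\mathbb{N}^n,\mathsf{p}\in\mathbb{N}^m$); $D$ is the set of finite linear combinations of these vectors. $a_k,a_k^\dagger$ ($k=1,\dots,n$) and $b_j,b_j^\dagger$ ($j=1,\dots,m$) are the annihilation/creation operators on the $k$-th, resp. $(n+j)$-th factor ($a_k e(\mathsf{s},\mathsf{p})=\sqrt{s_k}e(\mathsf{s}-\delta_k,\mathsf{p})$, $a_k^\dagger e(\mathsf{s},\mathsf{p})=\sqrt{s_k+1}e(\mathsf{s}+\delta_k,\mathsf{p})$, analogously for $b_j,b_j^\dagger$ on $\mathsf{p}$). Frequencies $w_i^s>0$, $w_j^p>0$. $N_s=\sum_i w_i^s a_i^\dagger a_i$, $N_p=\sum_j w_j^p b_j^\dagger b_j$, $N=N_s+N_p$ (self-adjoint, diagonal in the basis). $I=\prod_{i=1}^n a_i^\dagger\prod_{j=1}^m b_j-\prod_{i=1}^n a_i\prod_{j=1}^m b_j^\dagger$, $H=N_s+N_p+\frac{\mathrm{i}g}{2}I$ with $g$ a nonzero real constant. Channel operators, with arbitrary complex constants $\alpha^{(l)}_i$: $R^{(1)}_i=\alpha^{(1)}_ia_i$, $R^{(3)}_i=\alpha^{(3)}_ia_i$,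 $R^{(5)}_i=\alpha^{(5)}_ia_i$, $R^{(7)}_i=\alpha^{(7)}_ia_i^\dagger$ ($i=1,\dots,n$), $R^{(2)}_j=\alpha^{(2)}_jb_j$, $R^{(4)}_j=\alpha^{(4)}_jb_j$, $R^{(6)}_j=\alpha^{(6)}_jb_j$, $R^{(8)}_j=\alpha^{(8)}_jb_j^\dagger$ ($j=1,\dots,m$). Let $d=4(n+m)$ and let $R_1,\dots,R_d$ be an enumeration of these $d$ channel operators; $R=\sum_{i=1}^dR_i^*R_i$ and $K=-\mathrm{i}H-\frac12R$. The coefficient matrix $F=(F_{ij})_{0\le i,j\le d}$ is: $F_{00}=K$, $F_{i0}=R_i$, $F_{0j}=N_j:=-R_j^*$, and $F_{ij}=0$ for $i,j\ge1$; each $F_{ij}$ is understood as the closure of its restriction to $D$, and $F_{ij}^*$ denotes the adjoint. *)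

theory Defs
  imports "HOL-Analysis.Analysis" "HOL-Library.Complex_Order"
begin

text \<open>Hilbert space: the tensor product of n+m copies of l2(N) is realised as
  l2 of the index set of lists of naturals of length N = n+m; position k < n
  carries s_(k+1), position n+j (j < m) carries p_(j+1).
  A vector is a function vec with support in lists of length N.\<close>

type_synonym vec = "nat list \<Rightarrow> complex"

definition supp_ok :: "nat \<Rightarrow> vec \<Rightarrow> bool" where
  "supp_ok N u \<longleftrightarrow> (\<forall>x. length x \<noteq> N \<longrightarrow> u x = 0)"

definition ell2 :: "nat \<Rightarrow> vec \<Rightarrow> bool" where
  "ell2 N u \<longleftrightarrow> supp_ok N u \<and> (\<lambda>x. (cmod (u x))^2) summable_on UNIV"

definition Dfin :: "nat \<Rightarrow> vec set" where
  "Dfin N = {u. supp_ok N u \<and> finite {x. u x \<noteq> 0}}"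

definition vinner :: "vec \<Rightarrow> vec \<Rightarrow> complex" where
  "vinner u v = (\<Sum>\<^sub>\<infinity>x. cnj (u x) * v x)"

definition vnorm :: "vec \<Rightarrow> real" where
  "vnorm u = sqrt (\<Sum>\<^sub>\<infinity>x. (cmod (u x))^2)"

definition clos_graph :: "nat \<Rightarrow> (vec \<Rightarrow> vec) \<Rightarrow> (vec \<times> vec) set" where
  "clos_graph N T = {(u,v). ell2 N u \<and> ell2 N v \<and>
     (\<exists>U. (\<forall>k. U k \<in> Dfin N) \<and> (\<lambda>k. vnorm (U k - u)) \<longlonglongrightarrow> 0
          \<and> (\<lambda>k. vnorm (T (U k) - v)) \<longlonglongrightarrow> 0)}"

definition cdom :: "nat \<Rightarrow> (vec \<Rightarrow> vec) \<Rightarrow> vec set" where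
  "cdom N T = Domain (clos_graph N T)"

definition capp :: "nat \<Rightarrow> (vec \<Rightarrow> vec) \<Rightarrow> vec \<Rightarrow> vec" where
  "capp N T u = (THE v. (u,v) \<in> clos_graph N T)"

definition adj_graph :: "nat \<Rightarrow> (vec \<times> vec) set \<Rightarrow> (vec \<times> vec) set" where
  "adj_graph N G = {(v,w). ell2 N v \<and> ell2 N w \<and>
     (\<forall>(u,y)\<in>G. vinner v y = vinner w u)}"

definition adom :: "nat \<Rightarrow> (vec \<Rightarrow> vec) \<Rightarrow> vec set" where
  "adom N T = Domain (adj_graph N (clos_graph N T))"

definition aapp :: "nat \<Rightarrow> (vec \<Rightarrow> vec) \<Rightarrow> vec \<Rightarrow> vec" where
  "aapp N T v = (THE w. (v,w) \<in> adj_graph N (clos_graph N T))"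

definition lower :: "nat \<Rightarrow> vec \<Rightarrow> vec" where
  "lower q u = (\<lambda>x. complex_of_real (sqrt (real (x!q + 1))) * u (x[q := x!q + 1]))"

definition raise :: "nat \<Rightarrow> vec \<Rightarrow> vec" where
  "raise q u = (\<lambda>x. if x!q = 0 then 0
                    else complex_of_real (sqrt (real (x!q))) * u (x[q := x!q - 1]))"

definition energy :: "nat \<Rightarrow> nat \<Rightarrow> (nat \<Rightarrow> real) \<Rightarrow> (nat \<Rightarrow> real) \<Rightarrow> nat list \<Rightarrow> real" where
  "energy n m ws wp x = (\<Sum>k<n. ws k * real (x!k)) + (\<Sum>j<m. wp j * real (x!(n+j)))"

definition Nop :: "nat \<Rightarrow> nat \<Rightarrow> (nat \<Rightarrow> real) \<Rightarrow> (nat \<Rightarrow> real) \<Rightarrow> vec \<Rightarrow> vec" where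
  "Nop n m ws wp u = (\<lambda>x. complex_of_real (energy n m ws wp x) * u x)"

definition Iop :: "nat \<Rightarrow> nat \<Rightarrow> vec \<Rightarrow> vec" where
  "Iop n m u = (\<lambda>x.
      foldr (\<circ>) (map raise [0..<n] @ map lower [n..<n+m]) id u x
    - foldr (\<circ>) (map lower [0..<n] @ map raise [n..<n+m]) id u x)"

definition Hop :: "nat \<Rightarrow> nat \<Rightarrow> (nat \<Rightarrow> real) \<Rightarrow> (nat \<Rightarrow> real) \<Rightarrow> real \<Rightarrow> vec \<Rightarrow> vec" where
  "Hop n m ws wp g u = (\<lambda>x. Nop n m ws wp u x + \<i> * complex_of_real g / 2 * Iop n m u x)"

text \<open>Channels: (l,i) with l in {1,3,5,7}, i < n (acting on a_(i+1)), and
  (l,j) with l in {2,4,6,8}, j < m (acting on b_(j+1)).\<close>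
definition channels :: "nat \<Rightarrow> nat \<Rightarrow> (nat \<times> nat) set" where
  "channels n m = {(l,i). l \<in> {1,3,5,7} \<and> i < n} \<union> {(l,j). l \<in> {2,4,6,8} \<and> j < m}"

definition chanop :: "nat \<Rightarrow> (nat \<Rightarrow> nat \<Rightarrow> complex) \<Rightarrow> nat \<times> nat \<Rightarrow> vec \<Rightarrow> vec" where
  "chanop n alpha c u = (case c of (l,i) \<Rightarrow> (\<lambda>x. alpha l i *
      (if l \<in> {1,3,5} then lower i u x
       else if l = 7 then raise i u x
       else if l \<in> {2,4,6} then lower (n+i) u x
       else raise (n+i) u x)))"

definition Rsum :: "nat \<Rightarrow> nat \<Rightarrow> (nat \<Rightarrow> nat \<Rightarrow> complex) \<Rightarrow> (nat \<Rightarrow> nat \<times> nat) \<Rightarrow> vec \<Rightarrow> vec" where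
  "Rsum n m alpha enum u = (\<lambda>x. \<Sum>r\<in>{1..4*(n+m)}.
      aapp (n+m) (chanop n alpha (enum r)) (chanop n alpha (enum r) u) x)"

definition Kop :: "nat \<Rightarrow> nat \<Rightarrow> (nat \<Rightarrow> real) \<Rightarrow> (nat \<Rightarrow> real) \<Rightarrow> real
     \<Rightarrow> (nat \<Rightarrow> nat \<Rightarrow> complex) \<Rightarrow> (nat \<Rightarrow> nat \<times> nat) \<Rightarrow> vec \<Rightarrow> vec" where
  "Kop n m ws wp g alpha enum u =
     (\<lambda>x. - \<i> * Hop n m ws wp g u x - 1/2 * Rsum n m alpha enum u x)"

text \<open>Coefficient matrix F (before taking closures), indices 0..d.\<close>
definition Fop :: "nat \<Rightarrow> nat \<Rightarrow> (nat \<Rightarrow> real) \<Rightarrow> (nat \<Rightarrow> real) \<Rightarrow> real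
     \<Rightarrow> (nat \<Rightarrow> nat \<Rightarrow> complex) \<Rightarrow> (nat \<Rightarrow> nat \<times> nat) \<Rightarrow> nat \<Rightarrow> nat \<Rightarrow> vec \<Rightarrow> vec" where
  "Fop n m ws wp g alpha enum i j =
     (if i = 0 \<and> j = 0 then Kop n m ws wp g alpha enum
      else if j = 0 then chanop n alpha (enum i)
      else if i = 0 then (\<lambda>u x. - aapp (n+m) (chanop n alpha (enum j)) u x)
      else (\<lambda>u x. 0))"

text \<open>C = N^(2(n+m)) and its functional calculus (N is diagonal in the basis).\<close>
definition Chalf_dom :: "nat \<Rightarrow> nat \<Rightarrow> (nat \<Rightarrow> real) \<Rightarrow> (nat \<Rightarrow> real) \<Rightarrow> vec set" where
  "Chalf_dom n m ws wp = {u. ell2 (n+m) u \<and>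
      ell2 (n+m) (\<lambda>x. complex_of_real (energy n m ws wp x ^ (n+m)) * u x)}"

definition Ceps :: "nat \<Rightarrow> nat \<Rightarrow> (nat \<Rightarrow> real) \<Rightarrow> (nat \<Rightarrow> real) \<Rightarrow> real \<Rightarrow> vec \<Rightarrow> vec" where
  "Ceps n m ws wp \<epsilon> u = (\<lambda>x. complex_of_real
      (energy n m ws wp x ^ (2*(n+m)) / (1 + \<epsilon> * energy n m ws wp x ^ (2*(n+m)))^2) * u x)"

definition Ceps_half :: "nat \<Rightarrow> nat \<Rightarrow> (nat \<Rightarrow> real) \<Rightarrow> (nat \<Rightarrow> real) \<Rightarrow> real \<Rightarrow> vec \<Rightarrow> vec" where
  "Ceps_half n m ws wp \<epsilon> u = (\<lambda>x. complex_of_real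
      (energy n m ws wp x ^ (n+m) / (1 + \<epsilon> * energy n m ws wp x ^ (2*(n+m)))) * u x)"

end

(*
  On finite vectors the sum over i, j reduces, because C commutes with H (this is where the
  resonance condition enters), to a diagonal dissipation term at i = j = 0 and the commutators
  [C_epsilon, R_i] between u_i and u_0.  Both involve only differences of C_epsilon under a unit
  shift of one occupation number; these are bounded by A C_epsilon + B with constants independent
  of epsilon.  The (0,0) term extends to the closure of K by Fatou, using that C_epsilon is bounded.
  For the domain statements every operator and its formal adjoint are bounded between l2 spaces
  weighted by powers of the total occupation number.
*)
theory Submission
  imports Defs
begin

section \<open>Square-summable functions on lists\<close>

text \<open>Every operator is given by a formula on arbitrary functions supported on lists of length
  n+m, and its formal adjoint by another such formula. One coordinate of the image involves only
  finitely many coordinates of the argument, so the formula respects pointwise limits. Hence the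
  closure is a restriction of the formula, its adjoint acts on \<open>Dfin\<close> by the other
  formula, and the abstract \<open>THE\<close> values become computable. The obstacle in (b) is that
  membership in every \<open>cdom\<close> provides a separate approximating sequence for each F_ij.
  The commutator terms are therefore estimated directly on l2 vectors, by shifting the summation
  index, and only K goes through a sequence. The exponent 2(n+m) leaves room: I, whose terms are
  products of n+m ladder operators, costs the weight to the power n+m in the squared norm, whereas
  Dom(C^(1/2)) supplies the power 2(n+m). The constant b_2 comes from the vacuum alone: relative
  bounds on increments of C_epsilon hold only from the smallest frequency on.\<close>

lemma cmod_add_sq_le: "(cmod (a + b))\<^sup>2 \<le> 2 * (cmod a)\<^sup>2 + 2 * (cmod b)\<^sup>2"
proof -
  have "(cmod (a + b))\<^sup>2 \<le> (cmod a + cmod b)\<^sup>2"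
    by (intro power_mono norm_triangle_ineq) auto
  also have "\<dots> \<le> 2 * (cmod a)\<^sup>2 + 2 * (cmod b)\<^sup>2"
    using sum_squares_bound[of "cmod a" "cmod b"] by (simp add: power2_sum)
  finally show ?thesis .
qed

lemma supp_ok_add: "supp_ok N u \<Longrightarrow> supp_ok N v \<Longrightarrow> supp_ok N (\<lambda>x. u x + v x)"
  and supp_ok_diff: "supp_ok N u \<Longrightarrow> supp_ok N v \<Longrightarrow> supp_ok N (u - v)"
  and supp_ok_mult: "supp_ok N u \<Longrightarrow> supp_ok N (\<lambda>x. d x * u x)"
  by (auto simp: supp_ok_def)

lemma Dfin_supp_ok: "u \<in> Dfin N \<Longrightarrow> supp_ok N u"
  by (simp add: Dfin_def)

lemma ell2_supp_ok: "ell2 N u \<Longrightarrow> supp_ok N u"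
  by (simp add: ell2_def)

lemma Dfin_finite: "u \<in> Dfin N \<Longrightarrow> finite {x. u x \<noteq> 0}"
  by (simp add: Dfin_def)

lemma Dfin_add: "u \<in> Dfin N \<Longrightarrow> v \<in> Dfin N \<Longrightarrow> (\<lambda>x. u x + v x) \<in> Dfin N"
  unfolding Dfin_def
  by (auto simp: supp_ok_add intro: finite_subset[of _ "{x. u x \<noteq> 0} \<union> {x. v x \<noteq> 0}"])

lemma Dfin_mult: "u \<in> Dfin N \<Longrightarrow> (\<lambda>x. d x * u x) \<in> Dfin N"
  unfolding Dfin_def
  by (auto simp: supp_ok_def intro: finite_subset[of _ "{x. u x \<noteq> 0}"])

lemma summable_on_finite_support:
  fixes f :: "'a \<Rightarrow> 'b :: {comm_monoid_add, topological_space}"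
  assumes "finite {x. f x \<noteq> 0}"
  shows "f summable_on UNIV"
proof -
  have "f summable_on {x. f x \<noteq> 0} \<longleftrightarrow> f summable_on UNIV"
    by (rule summable_on_cong_neutral) auto
  then show ?thesis
    using summable_on_finite[OF assms, of f] by blast
qed

lemma summable_on_mult_Dfin:
  fixes f :: "nat list \<Rightarrow> complex"
  assumes "u \<in> Dfin N"
  shows "(\<lambda>x. cnj (u x) * f x) summable_on UNIV"
  using Dfin_finite[OF assms]
  by (intro summable_on_finite_support) (auto intro: finite_subset[of _ "{x. u x \<noteq> 0}"])

lemma Dfin_ell2: "u \<in> Dfin N \<Longrightarrow> ell2 N u"
  unfolding ell2_def using Dfin_finite[of u N]
  by (auto simp: Dfin_supp_ok intro!: summable_on_finite_support)

lemma ell2_bounded_mult: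
  assumes u: "ell2 N u" and d: "\<And>x. cmod (d x) \<le> M"
  shows "ell2 N (\<lambda>x. d x * u x)"
proof -
  have "(\<lambda>x. M\<^sup>2 * (cmod (u x))\<^sup>2) summable_on UNIV"
    using u by (intro summable_on_cmult_right) (simp add: ell2_def)
  then have "(\<lambda>x. (cmod (d x * u x))\<^sup>2) summable_on UNIV"
  proof (rule summable_on_comparison_test)
    show "(cmod (d x * u x))\<^sup>2 \<le> M\<^sup>2 * (cmod (u x))\<^sup>2" for x
      using d[of x] by (auto simp: norm_mult power_mult_distrib intro!: mult_right_mono power_mono)
  qed auto
  then show ?thesis
    using u by (simp add: ell2_def supp_ok_mult)
qed

lemma ell2_add:
  assumes "ell2 N u" "ell2 N v"
  shows "ell2 N (\<lambda>x. u x + v x)"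
proof -
  have "(\<lambda>x. 2 * (cmod (u x))\<^sup>2 + 2 * (cmod (v x))\<^sup>2) summable_on UNIV"
    using assms by (intro summable_on_add summable_on_cmult_right) (auto simp: ell2_def)
  then have "(\<lambda>x. (cmod (u x + v x))\<^sup>2) summable_on UNIV"
    by (rule summable_on_comparison_test) (auto simp: cmod_add_sq_le)
  then show ?thesis using assms by (simp add: ell2_def supp_ok_add)
qed

lemma ell2_diff:
  assumes "ell2 N u" "ell2 N v"
  shows "ell2 N (u - v)"
  using ell2_add[OF assms(1) ell2_bounded_mult[OF assms(2), of "\<lambda>_. -1" 1]]
  by (simp add: fun_diff_def)

lemma vnorm_nonneg: "vnorm u \<ge> 0"
  by (simp add: vnorm_def infsum_nonneg)

lemma vnorm_sq: "(vnorm u)\<^sup>2 = (\<Sum>\<^sub>\<infinity>x. (cmod (u x))\<^sup>2)"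
  by (simp add: vnorm_def infsum_nonneg)

lemma cmod_le_vnorm:
  assumes "ell2 N u"
  shows "cmod (u x) \<le> vnorm u"
proof -
  have "(\<Sum>x\<in>{x}. (cmod (u x))\<^sup>2) \<le> (\<Sum>\<^sub>\<infinity>x. (cmod (u x))\<^sup>2)"
    using assms by (intro finite_sum_le_infsum) (auto simp: ell2_def)
  then show ?thesis
    by (auto simp: vnorm_def intro: real_le_rsqrt)
qed

lemma vnorm_diff_tendsto_pointwise:
  assumes "\<And>k. ell2 N (U k)" "ell2 N u" "(\<lambda>k. vnorm (U k - u)) \<longlonglongrightarrow> 0"
  shows "(\<lambda>k. U k x) \<longlonglongrightarrow> u x"
proof (rule LIM_zero_cancel, rule Lim_null_comparison[OF _ assms(3)])
  show "\<forall>\<^sub>F k in sequentially. norm (U k x - u x) \<le> vnorm (U k - u)"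
    using cmod_le_vnorm[OF ell2_diff[OF assms(1,2)]] by simp
qed

lemma
  assumes u: "ell2 N u" and v: "ell2 N v"
  shows summable_on_vinner: "(\<lambda>x. cnj (u x) * v x) summable_on UNIV"
    and vinner_Cauchy_Schwarz: "cmod (vinner u v) \<le> vnorm u * vnorm v"
proof -
  have su: "(\<lambda>x. (cmod (u x))\<^sup>2) summable_on UNIV" and sv: "(\<lambda>x. (cmod (v x))\<^sup>2) summable_on UNIV"
    using u v by (auto simp: ell2_def)
  have fin: "(\<Sum>x\<in>F. cmod (cnj (u x) * v x)) \<le> vnorm u * vnorm v" if "finite F" for F
  proof -
    have "(\<Sum>x\<in>F. cmod (cnj (u x) * v x)) = (\<Sum>x\<in>F. \<bar>cmod (u x)\<bar> * \<bar>cmod (v x)\<bar>)"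
      by (simp add: norm_mult)
    also have "\<dots> \<le> L2_set (\<lambda>x. cmod (u x)) F * L2_set (\<lambda>x. cmod (v x)) F"
      by (rule L2_set_mult_ineq)
    also have "\<dots> \<le> vnorm u * vnorm v"
      unfolding L2_set_def vnorm_def using that
      by (intro mult_mono real_sqrt_le_mono finite_sum_le_infsum su sv)
         (auto intro!: sum_nonneg infsum_nonneg)
    finally show ?thesis .
  qed
  have abs: "(\<lambda>x. norm (cnj (u x) * v x)) summable_on UNIV"
    by (rule nonneg_bdd_above_summable_on) (auto intro!: bdd_aboveI2 fin)
  then show "(\<lambda>x. cnj (u x) * v x) summable_on UNIV"
    by (rule abs_summable_summable)
  have "cmod (vinner u v) \<le> (\<Sum>\<^sub>\<infinity>x. cmod (cnj (u x) * v x))"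
    unfolding vinner_def by (rule norm_infsum_bound[OF abs])
  also have "\<dots> \<le> vnorm u * vnorm v"
    by (rule infsum_le_finite_sums[OF abs]) (auto intro: fin)
  finally show "cmod (vinner u v) \<le> vnorm u * vnorm v" .
qed

lemma cnj_vinner: "cnj (vinner u v) = vinner v u"
  by (simp add: vinner_def flip: infsum_cnj) (simp add: mult.commute)

lemma vinner_mult_right: "vinner u (\<lambda>x. c * v x) = c * vinner u v"
  by (simp add: vinner_def mult.left_commute[of _ c] infsum_cmult_right')

lemma vinner_mult_left: "vinner (\<lambda>x. c * u x) v = cnj c * vinner u v"
  by (simp add: vinner_def mult.assoc infsum_cmult_right')

lemma vinner_zero_left [simp]: "vinner (\<lambda>x. 0) v = 0"
  and vinner_zero_right [simp]: "vinner u (\<lambda>x. 0) = 0"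
  by (simp_all add: vinner_def)

lemma vinner_real_mult_left:
  "vinner (\<lambda>x. complex_of_real (d x) * u x) v = vinner u (\<lambda>x. complex_of_real (d x) * v x)"
  by (simp add: vinner_def mult_ac)

text \<open>Finite support of \<open>u\<close> makes every series finite, so \<open>v\<close> and
  \<open>w\<close> may be arbitrary functions; this keeps the algebra of formal adjoints free of
  convergence questions.\<close>

lemma vinner_add_right_Dfin:
  "u \<in> Dfin N \<Longrightarrow> vinner u (\<lambda>x. v x + w x) = vinner u v + vinner u w"
  by (simp add: vinner_def distrib_left infsum_add summable_on_mult_Dfin)

lemma vinner_add_left_Dfin:
  "u \<in> Dfin N \<Longrightarrow> v \<in> Dfin N \<Longrightarrow> vinner (\<lambda>x. u x + v x) w = vinner u w + vinner v w"
  by (simp add: vinner_def distrib_right infsum_add summable_on_mult_Dfin)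

lemma vinner_add_right:
  "ell2 N u \<Longrightarrow> ell2 N v \<Longrightarrow> ell2 N w \<Longrightarrow> vinner u (\<lambda>x. v x + w x) = vinner u v + vinner u w"
  by (simp add: vinner_def distrib_left infsum_add summable_on_vinner)

lemma
  fixes f h :: "'a \<Rightarrow> 'b :: real_normed_vector"
  assumes f: "f summable_on A" and h: "h summable_on A"
  shows summable_on_diff: "(\<lambda>x. f x - h x) summable_on A"
    and infsum_diff: "(\<Sum>\<^sub>\<infinity>x\<in>A. f x - h x) = infsum f A - infsum h A"
proof -
  have h': "(\<lambda>x. - h x) summable_on A" using h by (simp add: summable_on_uminus)
  show "(\<lambda>x. f x - h x) summable_on A"
    using summable_on_add[OF f h'] by simp
  show "(\<Sum>\<^sub>\<infinity>x\<in>A. f x - h x) = infsum f A - infsum h A"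
    using infsum_add[OF f h'] by (simp add: infsum_uminus)
qed

lemma infsum_complex_of_real:
  "(\<Sum>\<^sub>\<infinity>x\<in>A. complex_of_real (f x)) = complex_of_real (infsum f A)"
proof (rule infsum_bounded_linear_strong[OF _ bounded_linear_of_real])
  show "(\<lambda>x. complex_of_real (f x)) summable_on A \<longleftrightarrow> f summable_on A"
    using summable_on_Re[of "\<lambda>x. complex_of_real (f x)" A] summable_on_of_real[of f A]
    by auto
qed

lemma vinner_real_diag_self:
  "vinner u (\<lambda>x. complex_of_real (d x) * u x)
    = complex_of_real (\<Sum>\<^sub>\<infinity>x. d x * (cmod (u x))\<^sup>2)"
proof -
  have "cnj (u x) * (complex_of_real (d x) * u x) = complex_of_real (d x * (cmod (u x))\<^sup>2)" for x
    unfolding of_real_mult complex_norm_square by (simp only: mult_ac)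
  then show ?thesis
    by (simp only: vinner_def infsum_complex_of_real)
qed

lemma summable_on_bounded_diag:
  assumes u: "ell2 N u" and d: "\<And>x. \<bar>d x\<bar> \<le> M"
  shows "(\<lambda>x. d x * (cmod (u x))\<^sup>2) summable_on UNIV"
proof -
  have "(\<lambda>x. M * (cmod (u x))\<^sup>2) summable_on UNIV"
    using u by (intro summable_on_cmult_right) (simp add: ell2_def)
  then have "(\<lambda>x. norm (d x * (cmod (u x))\<^sup>2)) summable_on UNIV"
  proof (rule Infinite_Sum.abs_summable_on_comparison_test')
    show "norm (d x * (cmod (u x))\<^sup>2) \<le> M * (cmod (u x))\<^sup>2" for x
      using mult_right_mono[OF d, of "(cmod (u x))\<^sup>2" x] by (simp add: abs_mult)
  qed
  then show ?thesis
    by (rule abs_summable_summable)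
qed

section \<open>Basis vectors and pairings with finite vectors\<close>

definition unitv :: "nat list \<Rightarrow> vec" where
  "unitv x = (\<lambda>y. if y = x then 1 else 0)"

lemma unitv_Dfin: "length x = N \<Longrightarrow> unitv x \<in> Dfin N"
  by (auto simp: Dfin_def unitv_def supp_ok_def)

lemma infsum_single_point: "(\<And>y. y \<noteq> x \<Longrightarrow> f y = (0::complex)) \<Longrightarrow> infsum f UNIV = f x"
  using infsum_cong_neutral[of UNIV "{x}" f f] by auto

lemma vinner_unitv_left: "vinner (unitv x) u = u x"
  unfolding vinner_def by (subst infsum_single_point[of x]) (auto simp: unitv_def)

lemma vinner_unitv_right: "vinner u (unitv x) = cnj (u x)"
  using cnj_vinner[of "unitv x" u] by (simp add: vinner_unitv_left)

lemma vinner_Dfin_sum: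
  assumes "v \<in> Dfin N"
  shows "vinner v u = (\<Sum>x | v x \<noteq> 0. cnj (v x) * u x)"
proof -
  have "vinner v u = (\<Sum>\<^sub>\<infinity>x | v x \<noteq> 0. cnj (v x) * u x)"
    unfolding vinner_def by (rule infsum_cong_neutral) auto
  then show ?thesis
    by (simp add: Dfin_finite[OF assms])
qed

text \<open>A bounded multiplier keeps the sesquilinear form continuous for the l2 norm. This is
  where boundedness of C_epsilon enters the passage from \<open>Dfin\<close> to the closure of
  K.\<close>

lemma vinner_diag_tendsto:
  assumes U: "\<And>k. ell2 N (U k)" and V: "\<And>k. ell2 N (V k)" and u: "ell2 N u" and v: "ell2 N v"
    and Ul: "(\<lambda>k. vnorm (U k - u)) \<longlonglongrightarrow> 0" and Vl: "(\<lambda>k. vnorm (V k - v)) \<longlonglongrightarrow> 0"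
    and d: "\<And>x. cmod (d x) \<le> M"
  shows "(\<lambda>k. vinner (U k) (\<lambda>x. d x * V k x)) \<longlonglongrightarrow> vinner u (\<lambda>x. d x * v x)"
proof -
  have M: "M \<ge> 0" using d[of "[]"] norm_ge_zero order_trans by blast
  have nd: "vnorm (\<lambda>x. d x * w x) \<le> M * vnorm w" if "ell2 N w" for w
  proof -
    have "(vnorm (\<lambda>x. d x * w x))\<^sup>2 \<le> (M * vnorm w)\<^sup>2"
      unfolding vnorm_sq power_mult_distrib infsum_cmult_right'[symmetric]
      using ell2_bounded_mult[OF that d] that d M
      by (intro infsum_mono summable_on_cmult_right)
         (auto simp: ell2_def norm_mult power_mult_distrib intro!: mult_right_mono power_mono)
    then show ?thesis using M vnorm_nonneg[of w] by (simp add: power2_le_iff_abs_le)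
  qed
  \<comment> \<open>Expansion around the limit: each of the three remaining terms has at least one
    small factor.\<close>
  have e: "vinner (U k) (\<lambda>x. d x * V k x) - vinner u (\<lambda>x. d x * v x)
     = vinner (U k - u) (\<lambda>x. d x * (V k - v) x) + vinner (U k - u) (\<lambda>x. d x * v x)
       + vinner u (\<lambda>x. d x * (V k - v) x)" for k
  proof -
    have a: "ell2 N (U k - u)" "ell2 N (\<lambda>x. d x * (V k - v) x)" "ell2 N (\<lambda>x. d x * v x)"
      using ell2_bounded_mult[OF ell2_diff[OF V v] d] U u v
      by (auto intro!: ell2_diff ell2_bounded_mult[OF _ d])
    have "vinner (U k) (\<lambda>x. d x * V k x)
      = vinner (\<lambda>x. (U k - u) x + u x) (\<lambda>x. d x * (V k - v) x + d x * v x)"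
      by (simp add: algebra_simps)
    also have "\<dots> = vinner (U k - u) (\<lambda>x. d x * (V k - v) x) + vinner (U k - u) (\<lambda>x. d x * v x)
       + vinner u (\<lambda>x. d x * (V k - v) x) + vinner u (\<lambda>x. d x * v x)"
    proof -
      have "vinner (\<lambda>x. (U k - u) x + u x) w = vinner (U k - u) w + vinner u w" if "ell2 N w" for w
        using vinner_add_right[OF that a(1) u] by (metis cnj_vinner complex_cnj_add)
      then show ?thesis
        using a u by (simp add: vinner_add_right ell2_add del: minus_apply)
    qed
    finally show ?thesis by simp
  qed
  have b: "cmod (vinner (U k) (\<lambda>x. d x * V k x) - vinner u (\<lambda>x. d x * v x))
     \<le> vnorm (U k - u) * (M * vnorm (V k - v)) + vnorm (U k - u) * (M * vnorm v)
       + vnorm u * (M * vnorm (V k - v))" for k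
  proof -
    have c: "cmod (vinner a (\<lambda>x. d x * b x)) \<le> vnorm a * (M * vnorm b)" if "ell2 N a" "ell2 N b" for a b
      by (rule order_trans[OF vinner_Cauchy_Schwarz[OF that(1) ell2_bounded_mult[OF that(2) d]]
            mult_left_mono[OF nd[OF that(2)] vnorm_nonneg]])
    show ?thesis unfolding e
      by (intro order_trans[OF norm_triangle_ineq] order_trans[OF norm_triangle_ineq add_right_mono]
          add_mono c ell2_diff U V u v)
  qed
  have "(\<lambda>k. vnorm (U k - u) * (M * vnorm (V k - v)) + vnorm (U k - u) * (M * vnorm v)
       + vnorm u * (M * vnorm (V k - v))) \<longlonglongrightarrow> 0 * (M * 0) + 0 * (M * vnorm v) + vnorm u * (M * 0)"
    by (intro tendsto_intros Ul Vl)
  then have "(\<lambda>k. vnorm (U k - u) * (M * vnorm (V k - v)) + vnorm (U k - u) * (M * vnorm v)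
       + vnorm u * (M * vnorm (V k - v))) \<longlonglongrightarrow> 0"
    by simp
  then show ?thesis
    by (rule LIM_zero_cancel[OF Lim_null_comparison[OF always_eventually[OF allI[OF b]]]])
qed

section \<open>Formally adjoint pairs of operators\<close>

text \<open>One plus the total occupation number. On lists of length n+m it is comparable with 1 +
  energy, but a ladder operator changes it by exactly one, whatever the frequencies.\<close>

definition wgt :: "nat list \<Rightarrow> real" where
  "wgt x = 1 + real (sum_list x)"

lemma wgt_ge_1: "wgt x \<ge> 1"
  by (simp add: wgt_def)

definition wsummable :: "nat \<Rightarrow> vec \<Rightarrow> bool" where
  "wsummable r u \<longleftrightarrow> (\<lambda>x. wgt x ^ r * (cmod (u x))\<^sup>2) summable_on UNIV"

definition wsq :: "nat \<Rightarrow> vec \<Rightarrow> real" where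
  "wsq r u = (\<Sum>\<^sub>\<infinity>x. wgt x ^ r * (cmod (u x))\<^sup>2)"

lemma wsq_nonneg: "wsq r u \<ge> 0"
  unfolding wsq_def using wgt_ge_1 order_trans[OF zero_le_one]
  by (intro infsum_nonneg mult_nonneg_nonneg zero_le_power) auto

lemma nonneg_comparison:
  fixes f h :: "'a \<Rightarrow> real"
  assumes h: "h summable_on A" and f: "\<And>x. x \<in> A \<Longrightarrow> 0 \<le> f x" "\<And>x. x \<in> A \<Longrightarrow> f x \<le> B * h x"
  shows "f summable_on A" and "infsum f A \<le> B * infsum h A"
proof -
  have Bh: "(\<lambda>x. B * h x) summable_on A" using h by (rule summable_on_cmult_right)
  then show fs: "f summable_on A"
    by (rule summable_on_comparison_test) (use f in auto)
  show "infsum f A \<le> B * infsum h A"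
    unfolding infsum_cmult_right'[symmetric] by (rule infsum_mono[OF fs Bh f(2)])
qed

text \<open>The order counts powers of \<open>wgt\<close> in the squared norm, so a product of p
  ladder operators has order p. Quantifying over all \<open>r\<close> makes orders add under
  composition: the outer operator needs a weighted bound on the output of the inner one.\<close>

definition order_le :: "nat \<Rightarrow> nat \<Rightarrow> (vec \<Rightarrow> vec) \<Rightarrow> bool" where
  "order_le N k T \<longleftrightarrow> (\<forall>r. \<exists>B\<ge>0. \<forall>u. supp_ok N u \<and> wsummable (r + k) u \<longrightarrow>
      wsummable r (T u) \<and> wsq r (T u) \<le> B * wsq (r + k) u)"

text \<open>\<open>u\<close> ranges over all functions with the right support, not only l2, since
  the pairing with \<open>v\<close> in \<open>Dfin\<close> is a finite sum. Taking a basis vector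
  for \<open>v\<close> recovers \<open>T u\<close> pointwise, which later yields linearity,
  continuity and uniqueness.\<close>

definition formal_adj :: "nat \<Rightarrow> (vec \<Rightarrow> vec) \<Rightarrow> (vec \<Rightarrow> vec) \<Rightarrow> bool" where
  "formal_adj N T S \<longleftrightarrow> (\<forall>u. supp_ok N u \<longrightarrow> supp_ok N (T u)) \<and> (\<forall>u\<in>Dfin N. T u \<in> Dfin N) \<and>
      (\<forall>v\<in>Dfin N. \<forall>u. supp_ok N u \<longrightarrow> vinner v (T u) = vinner (S v) u)"

definition adj_pair :: "nat \<Rightarrow> nat \<Rightarrow> (vec \<Rightarrow> vec) \<Rightarrow> (vec \<Rightarrow> vec) \<Rightarrow> bool" where
  "adj_pair N k T S \<longleftrightarrow> formal_adj N T S \<and> formal_adj N S T \<and> order_le N k T \<and> order_le N k S"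

lemma wsummable_antimono: "wsummable l u \<Longrightarrow> k \<le> l \<Longrightarrow> wsummable k u"
  and wsq_mono: "wsummable l u \<Longrightarrow> k \<le> l \<Longrightarrow> wsq k u \<le> wsq l u"
proof -
  assume l: "wsummable l u" and kl: "k \<le> l"
  have le: "wgt x ^ k * (cmod (u x))\<^sup>2 \<le> 1 * (wgt x ^ l * (cmod (u x))\<^sup>2)" for x
    using power_increasing[OF kl wgt_ge_1] by (simp add: mult_right_mono)
  have nn: "0 \<le> wgt x ^ k * (cmod (u x))\<^sup>2" for x
    using wgt_ge_1[of x] by simp
  note c = nonneg_comparison[OF l[unfolded wsummable_def] nn le]
  show "wsummable k u" using c(1) by (simp add: wsummable_def)
  show "wsq k u \<le> wsq l u" using c(2) by (simp add: wsq_def)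
qed

lemma order_le_mono:
  assumes "order_le N k T" "k \<le> l"
  shows "order_le N l T"
  unfolding order_le_def
proof
  fix r
  obtain B where B: "B \<ge> 0" "\<And>u. supp_ok N u \<Longrightarrow> wsummable (r + k) u \<Longrightarrow>
      wsummable r (T u) \<and> wsq r (T u) \<le> B * wsq (r + k) u"
    using assms(1) unfolding order_le_def by blast
  have "wsummable r (T u) \<and> wsq r (T u) \<le> B * wsq (r + l) u"
    if u: "supp_ok N u" "wsummable (r + l) u" for u
  proof -
    have "wsummable (r + k) u" "wsq (r + k) u \<le> wsq (r + l) u"
      using wsummable_antimono[OF u(2)] wsq_mono[OF u(2)] assms(2) by auto
    then show ?thesis
      using B(2)[OF u(1)] mult_left_mono[OF _ B(1)] by (meson order_trans)
  qed
  then show "\<exists>B\<ge>0. \<forall>u. supp_ok N u \<and> wsummable (r + l) u \<longrightarrow>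
      wsummable r (T u) \<and> wsq r (T u) \<le> B * wsq (r + l) u"
    using B(1) by blast
qed

lemma order_le_comp:
  assumes T1: "order_le N k1 T1" and T2: "order_le N k2 T2"
    and supp: "\<And>u. supp_ok N u \<Longrightarrow> supp_ok N (T2 u)"
  shows "order_le N (k1 + k2) (\<lambda>u. T1 (T2 u))"
  unfolding order_le_def
proof
  fix r
  obtain B1 where B1: "B1 \<ge> 0" "\<And>u. supp_ok N u \<Longrightarrow> wsummable (r + k1) u \<Longrightarrow>
      wsummable r (T1 u) \<and> wsq r (T1 u) \<le> B1 * wsq (r + k1) u"
    using T1 unfolding order_le_def by blast
  obtain B2 where B2: "B2 \<ge> 0" "\<And>u. supp_ok N u \<Longrightarrow> wsummable (r + k1 + k2) u \<Longrightarrow>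
      wsummable (r + k1) (T2 u) \<and> wsq (r + k1) (T2 u) \<le> B2 * wsq (r + k1 + k2) u"
    using T2 unfolding order_le_def by blast
  have "wsummable r (T1 (T2 u)) \<and> wsq r (T1 (T2 u)) \<le> (B1 * B2) * wsq (r + (k1 + k2)) u"
    if u: "supp_ok N u" "wsummable (r + (k1 + k2)) u" for u
    using B2(2)[OF u(1)] B1(2)[OF supp[OF u(1)]] u mult_left_mono[OF _ B1(1)]
    by (fastforce simp: add.assoc mult.assoc intro: order_trans)
  then show "\<exists>B\<ge>0. \<forall>u. supp_ok N u \<and> wsummable (r + (k1 + k2)) u \<longrightarrow>
      wsummable r (T1 (T2 u)) \<and> wsq r (T1 (T2 u)) \<le> B * wsq (r + (k1 + k2)) u"
    using B1(1) B2(1) by (intro exI[of _ "B1 * B2"]) auto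
qed

lemma order_le_add:
  assumes T1: "order_le N k T1" and T2: "order_le N k T2"
  shows "order_le N k (\<lambda>u x. T1 u x + T2 u x)"
  unfolding order_le_def
proof
  fix r
  obtain B1 where B1: "B1 \<ge> 0" "\<And>u. supp_ok N u \<Longrightarrow> wsummable (r + k) u \<Longrightarrow>
      wsummable r (T1 u) \<and> wsq r (T1 u) \<le> B1 * wsq (r + k) u"
    using T1 unfolding order_le_def by blast
  obtain B2 where B2: "B2 \<ge> 0" "\<And>u. supp_ok N u \<Longrightarrow> wsummable (r + k) u \<Longrightarrow>
      wsummable r (T2 u) \<and> wsq r (T2 u) \<le> B2 * wsq (r + k) u"
    using T2 unfolding order_le_def by blast
  have "wsummable r (\<lambda>x. T1 u x + T2 u x) \<and>
      wsq r (\<lambda>x. T1 u x + T2 u x) \<le> (2 * B1 + 2 * B2) * wsq (r + k) u"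
    if u: "supp_ok N u" "wsummable (r + k) u" for u
  proof -
    let ?f = "\<lambda>v x. wgt x ^ r * (cmod (v x))\<^sup>2"
    have s: "?f (T1 u) summable_on UNIV" "?f (T2 u) summable_on UNIV"
      using B1(2)[OF u] B2(2)[OF u] by (auto simp: wsummable_def)
    have h: "(\<lambda>x. ?f (T1 u) x + ?f (T2 u) x) summable_on UNIV"
      by (intro summable_on_add s)
    have nn: "0 \<le> ?f (\<lambda>x. T1 u x + T2 u x) x" for x
      using wgt_ge_1[of x] by simp
    have "?f (\<lambda>x. T1 u x + T2 u x) x \<le> 2 * (?f (T1 u) x + ?f (T2 u) x)" for x
      using mult_left_mono[OF cmod_add_sq_le, of "wgt x ^ r" "T1 u x" "T2 u x"] wgt_ge_1[of x]
      by (simp add: algebra_simps)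
    note c = nonneg_comparison[OF h nn this]
    have "wsq r (\<lambda>x. T1 u x + T2 u x) \<le> 2 * (wsq r (T1 u) + wsq r (T2 u))"
      using c(2) unfolding wsq_def by (simp only: infsum_add[OF s])
    then show ?thesis
      using c(1) B1(2)[OF u] B2(2)[OF u] by (auto simp: wsummable_def algebra_simps)
  qed
  then show "\<exists>B\<ge>0. \<forall>u. supp_ok N u \<and> wsummable (r + k) u \<longrightarrow>
      wsummable r (\<lambda>x. T1 u x + T2 u x) \<and> wsq r (\<lambda>x. T1 u x + T2 u x) \<le> B * wsq (r + k) u"
    using B1(1) B2(1) by (intro exI[of _ "2 * B1 + 2 * B2"]) auto
qed

lemma order_le_diag:
  assumes d: "\<And>x. length x = N \<Longrightarrow> (cmod (d x))\<^sup>2 \<le> M * wgt x ^ k" and M: "M \<ge> 0"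
  shows "order_le N k (\<lambda>u x. d x * u x)"
  unfolding order_le_def
proof
  fix r
  have "wsummable r (\<lambda>x. d x * u x) \<and> wsq r (\<lambda>x. d x * u x) \<le> M * wsq (r + k) u"
    if u: "supp_ok N u" "wsummable (r + k) u" for u
  proof -
    have nn: "0 \<le> wgt x ^ r * (cmod (d x * u x))\<^sup>2" for x
      using wgt_ge_1[of x] by simp
    have "wgt x ^ r * (cmod (d x * u x))\<^sup>2 \<le> M * (wgt x ^ (r + k) * (cmod (u x))\<^sup>2)" for x
    proof (cases "length x = N")
      case True
      have "wgt x ^ r * (cmod (d x * u x))\<^sup>2 = (wgt x ^ r * (cmod (u x))\<^sup>2) * (cmod (d x))\<^sup>2"
        by (simp add: norm_mult power_mult_distrib)
      also have "\<dots> \<le> (wgt x ^ r * (cmod (u x))\<^sup>2) * (M * wgt x ^ k)"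
        using wgt_ge_1[of x] by (intro mult_left_mono d True) auto
      finally show ?thesis by (simp add: power_add mult_ac)
    qed (use u in \<open>simp add: supp_ok_def\<close>)
    note c = nonneg_comparison[OF u(2)[unfolded wsummable_def] nn this]
    show ?thesis using c by (simp add: wsummable_def wsq_def)
  qed
  then show "\<exists>B\<ge>0. \<forall>u. supp_ok N u \<and> wsummable (r + k) u \<longrightarrow>
      wsummable r (\<lambda>x. d x * u x) \<and> wsq r (\<lambda>x. d x * u x) \<le> B * wsq (r + k) u"
    using M by blast
qed

lemma formal_adj_Dfin: "formal_adj N T S \<Longrightarrow> u \<in> Dfin N \<Longrightarrow> T u \<in> Dfin N"
  and formal_adj_supp: "formal_adj N T S \<Longrightarrow> supp_ok N u \<Longrightarrow> supp_ok N (T u)"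
  and formal_adj_vinner: "formal_adj N T S \<Longrightarrow> v \<in> Dfin N \<Longrightarrow> supp_ok N u \<Longrightarrow>
      vinner v (T u) = vinner (S v) u"
  by (auto simp: formal_adj_def)

text \<open>The reverse pairs enter because \<open>S1 v\<close> and \<open>S2 v\<close> must be
  finite vectors before the left argument of the pairing can be split.\<close>

lemma formal_adj_add:
  assumes "formal_adj N T1 S1" "formal_adj N T2 S2" "formal_adj N S1 T1" "formal_adj N S2 T2"
  shows "formal_adj N (\<lambda>u x. T1 u x + T2 u x) (\<lambda>u x. S1 u x + S2 u x)"
  using assms unfolding formal_adj_def
  by (simp add: supp_ok_add Dfin_add vinner_add_right_Dfin[of _ N] vinner_add_left_Dfin[of _ N])

lemma formal_adj_comp:
  assumes "formal_adj N T1 S1" "formal_adj N T2 S2" "formal_adj N S1 T1"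
  shows "formal_adj N (\<lambda>u. T1 (T2 u)) (\<lambda>u. S2 (S1 u))"
  using assms unfolding formal_adj_def by simp

lemma adj_pair_sym: "adj_pair N k T S \<Longrightarrow> adj_pair N k S T"
  by (simp add: adj_pair_def)

lemma adj_pair_mono: "adj_pair N k T S \<Longrightarrow> k \<le> l \<Longrightarrow> adj_pair N l T S"
  by (auto simp: adj_pair_def intro: order_le_mono)

lemma adj_pair_add:
  assumes "adj_pair N k T1 S1" "adj_pair N k T2 S2"
  shows "adj_pair N k (\<lambda>u x. T1 u x + T2 u x) (\<lambda>u x. S1 u x + S2 u x)"
  using assms by (simp add: adj_pair_def formal_adj_add order_le_add)

lemma adj_pair_comp:
  assumes "adj_pair N k1 T1 S1" "adj_pair N k2 T2 S2"
  shows "adj_pair N (k1 + k2) (\<lambda>u. T1 (T2 u)) (\<lambda>u. S2 (S1 u))"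
  unfolding adj_pair_def
proof (intro conjI)
  have f: "formal_adj N T1 S1" "formal_adj N S1 T1" "formal_adj N T2 S2" "formal_adj N S2 T2"
    and o: "order_le N k1 T1" "order_le N k1 S1" "order_le N k2 T2" "order_le N k2 S2"
    using assms by (auto simp: adj_pair_def)
  show "formal_adj N (\<lambda>u. T1 (T2 u)) (\<lambda>u. S2 (S1 u))"
    by (rule formal_adj_comp[OF f(1,3,2)])
  show "formal_adj N (\<lambda>u. S2 (S1 u)) (\<lambda>u. T1 (T2 u))"
    by (rule formal_adj_comp[OF f(4,2,3)])
  show "order_le N (k1 + k2) (\<lambda>u. T1 (T2 u))"
    by (rule order_le_comp[OF o(1,3) formal_adj_supp[OF f(3)]])
  show "order_le N (k1 + k2) (\<lambda>u. S2 (S1 u))"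
    unfolding add.commute[of k1 k2] by (rule order_le_comp[OF o(4,2) formal_adj_supp[OF f(2)]])
qed

lemma adj_pair_diag:
  assumes d: "\<And>x. length x = N \<Longrightarrow> (cmod (d x))\<^sup>2 \<le> M * wgt x ^ k" and M: "M \<ge> 0"
  shows "adj_pair N k (\<lambda>u x. d x * u x) (\<lambda>u x. cnj (d x) * u x)"
proof -
  have "vinner v (\<lambda>x. d x * u x) = vinner (\<lambda>x. cnj (d x) * v x) u" for d u v
    by (simp add: vinner_def mult_ac)
  moreover have "order_le N k (\<lambda>u x. d x * u x)" "order_le N k (\<lambda>u x. cnj (d x) * u x)"
    by (rule order_le_diag[OF _ M]; simp add: d)+
  ultimately show ?thesis
    unfolding adj_pair_def formal_adj_def
    by (auto simp: supp_ok_mult Dfin_mult simp del: complex_cnj_cnj) (simp add: vinner_def mult_ac)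
qed

lemma adj_pair_const: "adj_pair N 0 (\<lambda>u x. c * u x) (\<lambda>u x. cnj c * u x)"
  by (rule adj_pair_diag[of N _ "(cmod c)\<^sup>2"]) auto

lemma adj_pair_scale:
  assumes "adj_pair N k T S"
  shows "adj_pair N k (\<lambda>u x. c * T u x) (\<lambda>u x. cnj c * S u x)"
proof -
  note a = adj_pair_comp[OF adj_pair_const assms, of c]
  \<comment> \<open>Composition with the constant multiplier leaves \<open>cnj c\<close> inside the
    argument of \<open>S\<close>; pairing with basis vectors shows that \<open>S\<close> is
    homogeneous, so the factor can be moved outside.\<close>
  have lin: "S (\<lambda>x. cnj c * u x) x = cnj c * S u x" if "supp_ok N u" for u x
  proof (cases "length x = N")
    case True
    have SF: "formal_adj N S T" using assms by (simp add: adj_pair_def)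
    have "S (\<lambda>x. cnj c * u x) x = vinner (unitv x) (S (\<lambda>x. cnj c * u x))"
      by (simp add: vinner_unitv_left)
    also have "\<dots> = cnj c * vinner (T (unitv x)) u"
      using True that by (simp add: formal_adj_vinner[OF SF] unitv_Dfin supp_ok_mult vinner_mult_right)
    also have "\<dots> = cnj c * vinner (unitv x) (S u)"
      using True that by (simp add: formal_adj_vinner[OF SF] unitv_Dfin)
    finally show ?thesis by (simp add: vinner_unitv_left)
  next
    case False
    then show ?thesis
      using formal_adj_supp[of N S T] that assms by (simp add: adj_pair_def supp_ok_mult supp_ok_def)
  qed
  then have e: "S (\<lambda>x. cnj c * u x) = (\<lambda>x. cnj c * S u x)" if "supp_ok N u" for u
    using that by blast
  show ?thesis
    using a e unfolding adj_pair_def formal_adj_def order_le_def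
    by (simp add: Dfin_supp_ok)
qed

lemma adj_pair_uminus: "adj_pair N k T S \<Longrightarrow> adj_pair N k (\<lambda>u x. - T u x) (\<lambda>u x. - S u x)"
  using adj_pair_scale[of N k T S "-1"] by simp

lemma adj_pair_zero: "adj_pair N k (\<lambda>u x. 0) (\<lambda>u x. 0)"
  using adj_pair_mono[OF adj_pair_const[of N 0]] by simp

lemma adj_pair_id: "adj_pair N 0 id id"
  using adj_pair_const[of N 1] by (simp add: id_def)

lemma adj_pair_sum:
  assumes "finite A" "\<And>a. a \<in> A \<Longrightarrow> adj_pair N k (T a) (S a)"
  shows "adj_pair N k (\<lambda>u x. \<Sum>a\<in>A. T a u x) (\<lambda>u x. \<Sum>a\<in>A. S a u x)"
  using assms by (induction A rule: finite_induct) (auto simp: adj_pair_zero adj_pair_add)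

text \<open>Additivity is automatic: each coordinate of \<open>T w\<close> is the pairing of
  \<open>w\<close> with the fixed finite vector \<open>S (unitv x)\<close>.\<close>

lemma formal_adj_linear:
  assumes T: "formal_adj N T S" and u: "supp_ok N u" and v: "supp_ok N v"
    and S: "formal_adj N S T"
  shows "T (u - v) = T u - T v"
proof
  fix x
  show "T (u - v) x = (T u - T v) x"
  proof (cases "length x = N")
    case True
    then have D: "S (unitv x) \<in> Dfin N"
      by (intro formal_adj_Dfin[OF S] unitv_Dfin)
    have e: "T w x = vinner (S (unitv x)) w" if "supp_ok N w" for w
      using formal_adj_vinner[OF T unitv_Dfin[OF True] that] by (simp add: vinner_unitv_left)
    show ?thesis
      using u v by (simp add: e supp_ok_diff vinner_Dfin_sum[OF D] right_diff_distrib sum_subtractf)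
  qed (use formal_adj_supp[OF T] u v supp_ok_diff in \<open>auto simp: supp_ok_def\<close>)
qed

text \<open>The support of \<open>S (unitv x)\<close> contains all coordinates on which the value at
  \<open>x\<close> depends, so the limit passes through a finite sum.\<close>

lemma formal_adj_tendsto:
  assumes T: "formal_adj N T S" and S: "formal_adj N S T"
    and U: "\<And>k. supp_ok N (U k)" and u: "supp_ok N u" and l: "\<And>x. (\<lambda>k. U k x) \<longlonglongrightarrow> u x"
  shows "(\<lambda>k. T (U k) x) \<longlonglongrightarrow> T u x"
proof (cases "length x = N")
  case True
  then have D: "S (unitv x) \<in> Dfin N"
    by (intro formal_adj_Dfin[OF S] unitv_Dfin)
  have e: "T w x = vinner (S (unitv x)) w" if "supp_ok N w" for w
    using formal_adj_vinner[OF T unitv_Dfin[OF True] that] by (simp add: vinner_unitv_left)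
  show ?thesis
    unfolding e[OF U] e[OF u] vinner_Dfin_sum[OF D] by (intro tendsto_intros l)
qed (use formal_adj_supp[OF T] U u in \<open>auto simp: supp_ok_def\<close>)

section \<open>Closures and adjoints of formally adjoint pairs\<close>

lemma clos_graph_cong:
  assumes "\<And>u. u \<in> Dfin N \<Longrightarrow> T u = T' u"
  shows "clos_graph N T = clos_graph N T'"
  using assms unfolding clos_graph_def by (auto 4 4)

text \<open>Norm limits are coordinatewise limits, and \<open>T\<close> respects these. In
  particular the operator is closable, and its closure acts by the same formula wherever it is
  defined.\<close>

lemma clos_graph_formal:
  assumes T: "formal_adj N T S" and S: "formal_adj N S T" and uv: "(u, v) \<in> clos_graph N T"
  shows "v = T u"
proof
  fix x
  obtain U where u: "ell2 N u" and v: "ell2 N v" and U: "\<And>k. U k \<in> Dfin N"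
    and l: "(\<lambda>k. vnorm (U k - u)) \<longlonglongrightarrow> 0" "(\<lambda>k. vnorm (T (U k) - v)) \<longlonglongrightarrow> 0"
    using uv unfolding clos_graph_def by blast
  have "(\<lambda>k. T (U k) x) \<longlonglongrightarrow> T u x"
    by (intro formal_adj_tendsto[OF T S] vnorm_diff_tendsto_pointwise[OF _ u l(1)]
        Dfin_ell2 Dfin_supp_ok U ell2_supp_ok u)
  moreover have "(\<lambda>k. T (U k) x) \<longlonglongrightarrow> v x"
    by (intro vnorm_diff_tendsto_pointwise[OF _ v l(2)] Dfin_ell2 formal_adj_Dfin[OF T] U)
  ultimately show "v x = T u x"
    by (rule LIMSEQ_unique[symmetric])
qed

lemma capp_formal:
  assumes "formal_adj N T S" "formal_adj N S T" "u \<in> cdom N T"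
  shows "(u, T u) \<in> clos_graph N T" and "capp N T u = T u"
proof -
  obtain v where v: "(u, v) \<in> clos_graph N T"
    using assms(3) unfolding cdom_def by blast
  then show *: "(u, T u) \<in> clos_graph N T"
    using clos_graph_formal[OF assms(1,2)] by blast
  show "capp N T u = T u"
    unfolding capp_def by (rule the_equality, rule *, rule clos_graph_formal[OF assms(1,2)])
qed

text \<open>Existence is formal adjointness applied on the graph of the closure; uniqueness follows
  by testing with basis vectors, which lie in the domain of the closure.\<close>

lemma aapp_formal:
  assumes T: "formal_adj N T S" and S: "formal_adj N S T" and v: "v \<in> Dfin N"
  shows "v \<in> adom N T" and "aapp N T v = S v"
proof -
  have mem: "(v, S v) \<in> adj_graph N (clos_graph N T)"
  proof -
    have "vinner v y = vinner (S v) u" if "(u, y) \<in> clos_graph N T" for u y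
    proof -
      have "y = T u" by (rule clos_graph_formal[OF T S that])
      moreover have "supp_ok N u" using that by (simp add: clos_graph_def ell2_supp_ok)
      ultimately show ?thesis using formal_adj_vinner[OF T v] by simp
    qed
    then show ?thesis
      unfolding adj_graph_def using formal_adj_Dfin[OF S v] v by (auto simp: Dfin_ell2)
  qed
  then show "v \<in> adom N T"
    unfolding adom_def by blast
  show "aapp N T v = S v"
    unfolding aapp_def
  proof (rule the_equality, rule mem)
    fix w assume w: "(v, w) \<in> adj_graph N (clos_graph N T)"
    show "w = S v"
    proof
      fix x
      show "w x = S v x"
      proof (cases "length x = N")
        case True
        then have x: "unitv x \<in> Dfin N" by (rule unitv_Dfin)
        have "(unitv x, T (unitv x)) \<in> clos_graph N T"
          unfolding clos_graph_def using x formal_adj_Dfin[OF T x]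
          by (auto simp: Dfin_ell2 vnorm_def intro!: exI[of _ "\<lambda>_. unitv x"])
        then have "vinner w (unitv x) = vinner (S v) (unitv x)"
          using w mem unfolding adj_graph_def by fastforce
        then show ?thesis by (simp add: vinner_unitv_right)
      next
        case False
        then show ?thesis
          using w mem unfolding adj_graph_def by (auto simp: ell2_def supp_ok_def)
      qed
    qed
  qed
qed

section \<open>Density of finite vectors in the weighted spaces\<close>

lemma wsummable_0_iff: "ell2 N u \<longleftrightarrow> supp_ok N u \<and> wsummable 0 u"
  by (simp add: ell2_def wsummable_def)

lemma vnorm_wsq: "(vnorm u)\<^sup>2 = wsq 0 u"
  by (simp add: vnorm_sq wsq_def)

lemma wsq_truncation:
  assumes u: "supp_ok N u" "wsummable k u" and e: "e > 0"
  obtains v where "v \<in> Dfin N" "wsummable k (v - u)" "wsq k (v - u) < e"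
proof -
  let ?f = "\<lambda>x. wgt x ^ k * (cmod (u x))\<^sup>2"
  have s: "?f summable_on UNIV" using u(2) by (simp add: wsummable_def)
  have "(sum ?f \<longlongrightarrow> infsum ?f UNIV) (finite_subsets_at_top UNIV)"
    using has_sum_infsum[OF s] by (simp add: has_sum_def)
  then have "\<forall>\<^sub>F X in finite_subsets_at_top UNIV. dist (sum ?f X) (infsum ?f UNIV) < e"
    using e by (rule tendstoD)
  then obtain X where X: "finite X" "dist (sum ?f X) (infsum ?f UNIV) < e"
    unfolding eventually_finite_subsets_at_top by blast
  define v where "v = (\<lambda>x. if x \<in> X then u x else 0)"
  have "v \<in> Dfin N"
    using u(1) X(1) by (auto simp: Dfin_def v_def supp_ok_def)
  have sc: "?f summable_on (UNIV - X)"
    using s X(1) by (intro summable_on_Diff) auto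
  have f: "wgt x ^ k * (cmod ((v - u) x))\<^sup>2 = (if x \<in> X then 0 else ?f x)" for x
    by (simp add: v_def)
  have "?f summable_on (UNIV - X) \<longleftrightarrow> (\<lambda>x. if x \<in> X then 0 else ?f x) summable_on UNIV"
    by (rule summable_on_cong_neutral) auto
  then have ws: "wsummable k (v - u)"
    unfolding wsummable_def f using sc by blast
  have "wsq k (v - u) = infsum ?f (UNIV - X)"
    unfolding wsq_def f by (rule infsum_cong_neutral) auto
  then have "wsq k (v - u) = infsum ?f UNIV - sum ?f X"
    using infsum_Diff[OF s, of X] X(1) by simp
  then have "wsq k (v - u) < e"
    using X(2) by (simp add: dist_real_def)
  with ws show thesis
    using that \<open>v \<in> Dfin N\<close> by blast
qed

text \<open>Finite truncations of \<open>u\<close> converge in the weighted norm, which dominates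
  the l2 norm and in which \<open>T\<close> is bounded into l2; one sequence therefore serves both
  limits in the closure.\<close>

lemma weighted_subset_cdom:
  assumes T: "adj_pair N k T S" and u: "supp_ok N u" "wsummable k u"
  shows "u \<in> cdom N T"
proof -
  obtain B where B: "B \<ge> 0" "\<And>u. supp_ok N u \<Longrightarrow> wsummable k u \<Longrightarrow>
      wsummable 0 (T u) \<and> wsq 0 (T u) \<le> B * wsq k u"
    using T unfolding adj_pair_def order_le_def by (metis add_0)
  have "\<forall>l. \<exists>v. v \<in> Dfin N \<and> wsummable k (v - u) \<and> wsq k (v - u) < inverse (real (Suc l))"
    using wsq_truncation[OF u] by (metis inverse_positive_iff_positive of_nat_0_less_iff zero_less_Suc)
  then obtain U where U: "\<And>l. U l \<in> Dfin N" "\<And>l. wsummable k (U l - u)"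
      "\<And>l. wsq k (U l - u) < inverse (real (Suc l))"
    by metis
  have w0: "(\<lambda>l. wsq k (U l - u)) \<longlonglongrightarrow> 0"
    by (rule tendsto_sandwich[OF _ _ tendsto_const LIMSEQ_inverse_real_of_nat])
       (auto intro!: always_eventually simp: wsq_nonneg less_imp_le[OF U(3)] simp del: of_nat_Suc)
  have lim: "(\<lambda>l. vnorm (V l)) \<longlonglongrightarrow> 0" if "\<And>l. wsq 0 (V l) \<le> C * wsq k (U l - u)" for V C
  proof -
    have "(\<lambda>l. wsq 0 (V l)) \<longlonglongrightarrow> 0"
      by (rule tendsto_sandwich[OF _ _ tendsto_const tendsto_mult_right_zero[OF w0, of C]])
         (auto intro!: always_eventually simp: wsq_nonneg that)
    then have "(\<lambda>l. sqrt ((vnorm (V l))\<^sup>2)) \<longlonglongrightarrow> sqrt 0"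
      unfolding vnorm_wsq by (rule tendsto_real_sqrt)
    then show ?thesis by (simp add: vnorm_nonneg)
  qed
  have F: "formal_adj N T S" "formal_adj N S T" using T by (auto simp: adj_pair_def)
  have su: "supp_ok N (U l)" for l using U(1) by (rule Dfin_supp_ok)
  have 1: "(\<lambda>l. vnorm (U l - u)) \<longlonglongrightarrow> 0"
    by (rule lim[of _ 1]) (use wsq_mono[OF U(2)] in auto)
  have 2: "(\<lambda>l. vnorm (T (U l) - T u)) \<longlonglongrightarrow> 0"
    unfolding formal_adj_linear[OF F(1) su u(1) F(2), symmetric]
    by (rule lim[of _ B]) (use B(2)[OF supp_ok_diff[OF su u(1)] U(2)] in auto)
  have "ell2 N u" "ell2 N (T u)"
    using u wsummable_antimono[OF u(2), of 0] B(2)[OF u] formal_adj_supp[OF F(1) u(1)]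
    by (auto simp: wsummable_0_iff)
  then have "(u, T u) \<in> clos_graph N T"
    unfolding clos_graph_def using U(1) 1 2 by auto
  then show ?thesis by (auto simp: cdom_def)
qed

text \<open>Prepared for claim (a): \<open>T\<close> will be the formal adjoint of F_ij and
  \<open>d\<close> the eigenvalues of C_epsilon^(1/2), whose decay offsets the order of
  \<open>T\<close>.\<close>

lemma order_le_bounded:
  assumes T: "order_le N k T" and d: "\<And>x. length x = N \<Longrightarrow> wgt x ^ k * (d x)\<^sup>2 \<le> C"
  shows "\<exists>M. \<forall>u\<in>Dfin N. vnorm (T (\<lambda>x. complex_of_real (d x) * u x)) \<le> M * vnorm u"
proof -
  obtain B where B: "B \<ge> 0" "\<And>u. supp_ok N u \<Longrightarrow> wsummable k u \<Longrightarrow>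
      wsummable 0 (T u) \<and> wsq 0 (T u) \<le> B * wsq k u"
    using T unfolding order_le_def by (metis add_0)
  have C: "C \<ge> 0" using d[of "replicate N 0"] wgt_ge_1[of "replicate N 0"]
    by (meson length_replicate order_trans mult_nonneg_nonneg zero_le_power zero_le_power2 zero_le_one)
  have "vnorm (T (\<lambda>x. complex_of_real (d x) * u x)) \<le> sqrt (B * C) * vnorm u" if u: "u \<in> Dfin N" for u
  proof -
    let ?v = "\<lambda>x. complex_of_real (d x) * u x"
    have le: "wgt x ^ k * (cmod (?v x))\<^sup>2 \<le> C * (cmod (u x))\<^sup>2" for x
    proof (cases "length x = N")
      case True
      show ?thesis using mult_right_mono[OF d[OF True], of "(cmod (u x))\<^sup>2"]
        by (simp add: norm_mult power_mult_distrib mult_ac)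
    qed (use Dfin_supp_ok[OF u] in \<open>simp add: supp_ok_def\<close>)
    have nn: "0 \<le> wgt x ^ k * (cmod (?v x))\<^sup>2" for x using wgt_ge_1[of x] by simp
    have s: "(\<lambda>x. (cmod (u x))\<^sup>2) summable_on UNIV"
      using Dfin_ell2[OF u] by (simp add: ell2_def)
    note c = nonneg_comparison[OF s nn le]
    have "wsummable k ?v" "wsq k ?v \<le> C * wsq 0 u"
      using c by (auto simp: wsummable_def wsq_def)
    then have "(vnorm (T ?v))\<^sup>2 \<le> B * (C * wsq 0 u)"
      unfolding vnorm_wsq
      using B(2)[OF Dfin_supp_ok[OF Dfin_mult[OF u]]] mult_left_mono[OF _ B(1)]
      by (meson order_trans)
    also have "\<dots> = (sqrt (B * C) * vnorm u)\<^sup>2"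
      using B(1) C by (simp add: power_mult_distrib vnorm_wsq)
    finally show ?thesis
      by (rule power2_le_imp_le) (use B(1) C vnorm_nonneg in auto)
  qed
  then show ?thesis by blast
qed

section \<open>Ladder operators\<close>

text \<open>Substitution y = x + delta_q: adding a quantum maps the lists of length N bijectively
  onto those with nonzero entry q. The vanishing hypotheses let both sums run over all
  lists.\<close>

lemma
  fixes f h :: "nat list \<Rightarrow> 'a :: {comm_monoid_add, t2_space}"
  assumes q: "q < N" and f: "\<And>x. length x \<noteq> N \<Longrightarrow> f x = 0"
    and h: "\<And>y. length y \<noteq> N \<or> y ! q = 0 \<Longrightarrow> h y = 0"
    and fh: "\<And>x. length x = N \<Longrightarrow> f x = h (x[q := x ! q + 1])"
  shows infsum_shift: "infsum f UNIV = infsum h UNIV"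
    and summable_on_shift: "f summable_on UNIV \<longleftrightarrow> h summable_on UNIV"
proof -
  let ?S = "{x :: nat list. length x = N}" and ?T = "{y :: nat list. length y = N \<and> y ! q \<noteq> 0}"
  let ?j = "\<lambda>x :: nat list. x[q := x ! q + 1]" and ?i = "\<lambda>y :: nat list. y[q := y ! q - 1]"
  have b: "bij_betw ?j ?S ?T"
    by (rule bij_betw_byWitness[where f' = ?i]) (use q in auto)
  have "infsum f UNIV = infsum f ?S"
    by (rule infsum_cong_neutral) (use f in auto)
  also have "\<dots> = infsum (\<lambda>x. h (?j x)) ?S"
    by (rule infsum_cong) (use fh in auto)
  also have "\<dots> = infsum h ?T"
    by (rule infsum_reindex_bij_betw[OF b])
  also have "\<dots> = infsum h UNIV"
    by (rule infsum_cong_neutral) (use h in auto)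
  finally show "infsum f UNIV = infsum h UNIV" .
  have "f summable_on UNIV \<longleftrightarrow> f summable_on ?S"
    by (rule summable_on_cong_neutral) (use f in auto)
  also have "\<dots> \<longleftrightarrow> (\<lambda>x. h (?j x)) summable_on ?S"
    by (rule summable_on_cong) (use fh in auto)
  also have "\<dots> \<longleftrightarrow> h summable_on ?T"
    by (rule summable_on_reindex_bij_betw[OF b])
  also have "\<dots> \<longleftrightarrow> h summable_on UNIV"
    by (rule summable_on_cong_neutral) (use h in auto)
  finally show "f summable_on UNIV \<longleftrightarrow> h summable_on UNIV" .
qed

lemma lower_supp_ok: "supp_ok N u \<Longrightarrow> supp_ok N (lower q u)"
  and raise_supp_ok: "supp_ok N u \<Longrightarrow> supp_ok N (raise q u)"
  by (auto simp: supp_ok_def lower_def raise_def)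

text \<open>The substitution matches the two series term by term, so the identity also covers
  functions outside l2, and summability transfers from either side to the other.\<close>

lemma
  assumes q: "q < N" and u: "supp_ok N u" and v: "supp_ok N v"
  shows vinner_lower: "vinner v (lower q u) = vinner (raise q v) u"
    and summable_on_vinner_lower: "(\<lambda>x. cnj (v x) * lower q u x) summable_on UNIV \<longleftrightarrow>
      (\<lambda>x. cnj (raise q v x) * u x) summable_on UNIV"
proof -
  have a: "cnj (v x) * lower q u x = 0" if "length x \<noteq> N" for x
    using that v by (simp add: supp_ok_def)
  have b: "cnj (raise q v y) * u y = 0" if "length y \<noteq> N \<or> y ! q = 0" for y
    using that u by (auto simp: supp_ok_def raise_def)
  have c: "cnj (v x) * lower q u x = cnj (raise q v (x[q := x ! q + 1])) * u (x[q := x ! q + 1])"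
    if "length x = N" for x
    using that q by (simp add: lower_def raise_def)
  show "vinner v (lower q u) = vinner (raise q v) u"
    unfolding vinner_def by (rule infsum_shift[OF q]) (fact a, fact b, fact c)
  show "(\<lambda>x. cnj (v x) * lower q u x) summable_on UNIV \<longleftrightarrow>
      (\<lambda>x. cnj (raise q v x) * u x) summable_on UNIV"
    by (rule summable_on_shift[OF q]) (fact a, fact b, fact c)
qed

lemma lower_Dfin:
  assumes q: "q < N" and u: "u \<in> Dfin N"
  shows "lower q u \<in> Dfin N"
proof -
  have "{x. lower q u x \<noteq> 0} \<subseteq> (\<lambda>y. y[q := y ! q - 1]) ` {y. u y \<noteq> 0}"
  proof
    fix x assume "x \<in> {x. lower q u x \<noteq> 0}"
    then have "lower q u x \<noteq> 0" by simp
    then have "u (x[q := x ! q + 1]) \<noteq> 0" "length x = N"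
      using lower_supp_ok[OF Dfin_supp_ok[OF u]] by (auto simp: lower_def supp_ok_def)
    then show "x \<in> (\<lambda>y. y[q := y ! q - 1]) ` {y. u y \<noteq> 0}"
      using q by (intro image_eqI[of _ _ "x[q := x ! q + 1]"]) auto
  qed
  then show ?thesis
    using u finite_surj[OF Dfin_finite[OF u]] by (simp add: Dfin_def lower_supp_ok)
qed

lemma raise_Dfin:
  assumes q: "q < N" and u: "u \<in> Dfin N"
  shows "raise q u \<in> Dfin N"
proof -
  have "{x. raise q u x \<noteq> 0} \<subseteq> (\<lambda>y. y[q := y ! q + 1]) ` {y. u y \<noteq> 0}"
  proof
    fix x assume "x \<in> {x. raise q u x \<noteq> 0}"
    then have "raise q u x \<noteq> 0" by simp
    then have "u (x[q := x ! q - 1]) \<noteq> 0" "x ! q \<noteq> 0" "length x = N"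
      using raise_supp_ok[OF Dfin_supp_ok[OF u], of q]
      by (auto simp: raise_def split: if_splits) (auto simp: supp_ok_def)
    then show "x \<in> (\<lambda>y. y[q := y ! q + 1]) ` {y. u y \<noteq> 0}"
      using q by (intro image_eqI[of _ _ "x[q := x ! q - 1]"]) auto
  qed
  then show ?thesis
    using u finite_surj[OF Dfin_finite[OF u]] by (simp add: Dfin_def raise_supp_ok)
qed

lemma wgt_update:
  assumes "q < length x"
  shows "wgt (x[q := x ! q + 1]) = wgt x + 1" and "real (x ! q) + 1 \<le> wgt x"
  using assms elem_le_sum_list[OF assms] by (auto simp: wgt_def sum_list_update)

lemma order_le_lower:
  assumes q: "q < N"
  shows "order_le N 1 (lower q)"
  unfolding order_le_def
proof
  fix r
  have "wsummable r (lower q u) \<and> wsq r (lower q u) \<le> 1 * wsq (r + 1) u"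
    if u: "supp_ok N u" "wsummable (r + 1) u" for u
  proof -
    let ?f = "\<lambda>x. wgt x ^ r * (cmod (lower q u x))\<^sup>2"
    \<comment> \<open>The summand after substituting y = x + delta_q: the squared root factor
      becomes the occupation number of \<open>y\<close>, which \<open>wgt y\<close> absorbs.\<close>
    let ?h = "\<lambda>y. if y ! q = 0 then 0 else wgt (y[q := y ! q - 1]) ^ r * (real (y ! q) * (cmod (u y))\<^sup>2)"
    have a: "?f x = 0" if "length x \<noteq> N" for x
      using that u(1) lower_supp_ok[of N u q] by (simp add: supp_ok_def)
    have b: "?h y = 0" if "length y \<noteq> N \<or> y ! q = 0" for y
      using that u(1) by (auto simp: supp_ok_def)
    have c: "?f x = ?h (x[q := x ! q + 1])" if "length x = N" for x
      using that q by (simp add: lower_def norm_mult power_mult_distrib add_ac)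
    have nn: "0 \<le> ?h y" for y using wgt_ge_1[of "y[q := y ! q - 1]"] by simp
    have le: "?h y \<le> 1 * (wgt y ^ (r + 1) * (cmod (u y))\<^sup>2)" for y
    proof (cases "length y = N \<and> y ! q \<noteq> 0")
      case True
      then have "wgt y = wgt (y[q := y ! q - 1]) + 1"
        using wgt_update(1)[of q "y[q := y ! q - 1]"] q by simp
      then have "wgt (y[q := y ! q - 1]) ^ r * real (y ! q) \<le> wgt y ^ r * wgt y"
        using wgt_update(2)[of q y] q True wgt_ge_1[of "y[q := y ! q - 1]"]
        by (intro mult_mono power_mono) auto
      from mult_right_mono[OF this, of "(cmod (u y))\<^sup>2"] True show ?thesis
        by (simp add: mult_ac)
    next
      case False
      then have "?h y = 0" using b by blast
      moreover have "0 \<le> wgt y ^ (r + 1) * (cmod (u y))\<^sup>2" using wgt_ge_1[of y] by simp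
      ultimately show ?thesis by linarith
    qed
    note n = nonneg_comparison[OF u(2)[unfolded wsummable_def] nn le]
    have i: "infsum ?f UNIV = infsum ?h UNIV"
      by (rule infsum_shift[OF q]) (fact a, fact b, fact c)
    have s: "?f summable_on UNIV \<longleftrightarrow> ?h summable_on UNIV"
      by (rule summable_on_shift[OF q]) (fact a, fact b, fact c)
    show ?thesis
      unfolding wsummable_def wsq_def using n i s by (simp only: simp_thms)
  qed
  then show "\<exists>B\<ge>0. \<forall>u. supp_ok N u \<and> wsummable (r + 1) u \<longrightarrow>
      wsummable r (lower q u) \<and> wsq r (lower q u) \<le> B * wsq (r + 1) u"
    using zero_le_one by blast
qed

lemma order_le_raise:
  assumes q: "q < N"
  shows "order_le N 1 (raise q)"
  unfolding order_le_def
proof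
  fix r
  have "wsummable r (raise q u) \<and> wsq r (raise q u) \<le> 2 ^ r * wsq (r + 1) u"
    if u: "supp_ok N u" "wsummable (r + 1) u" for u
  proof -
    let ?h = "\<lambda>x. wgt x ^ r * (cmod (raise q u x))\<^sup>2"
    let ?f = "\<lambda>x. wgt (x[q := x ! q + 1]) ^ r * ((real (x ! q) + 1) * (cmod (u x))\<^sup>2)"
    have a: "?f x = 0" if "length x \<noteq> N" for x
      using that u(1) by (simp add: supp_ok_def)
    have b: "?h y = 0" if "length y \<noteq> N \<or> y ! q = 0" for y
      using that u(1) by (auto simp: supp_ok_def raise_def)
    have c: "?f x = ?h (x[q := x ! q + 1])" if "length x = N" for x
      using that q by (simp add: raise_def norm_mult power_mult_distrib add_ac)
    have nn: "0 \<le> ?f x" for x using wgt_ge_1[of "x[q := x ! q + 1]"] by simp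
    have le: "?f x \<le> 2 ^ r * (wgt x ^ (r + 1) * (cmod (u x))\<^sup>2)" for x
    proof (cases "length x = N")
      case True
      \<comment> \<open>The factor 2^r in the bound comes from wgt x + 1 <= 2 * wgt x.\<close>
      have "wgt (x[q := x ! q + 1]) ^ r * (real (x ! q) + 1) \<le> (2 * wgt x) ^ r * wgt x"
        using wgt_update[of q x] q True wgt_ge_1[of x]
        by (intro mult_mono power_mono) auto
      from mult_right_mono[OF this, of "(cmod (u x))\<^sup>2"] show ?thesis
        by (simp add: mult_ac power_mult_distrib)
    next
      case False
      then show ?thesis using a u(1) by (simp add: supp_ok_def)
    qed
    note n = nonneg_comparison[OF u(2)[unfolded wsummable_def] nn le]
    have i: "infsum ?f UNIV = infsum ?h UNIV"
      by (rule infsum_shift[OF q]) (fact a, fact b, fact c)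
    have s: "?f summable_on UNIV \<longleftrightarrow> ?h summable_on UNIV"
      by (rule summable_on_shift[OF q]) (fact a, fact b, fact c)
    show ?thesis
      unfolding wsummable_def wsq_def using n i s by (simp only: simp_thms)
  qed
  then show "\<exists>B\<ge>0. \<forall>u. supp_ok N u \<and> wsummable (r + 1) u \<longrightarrow>
      wsummable r (raise q u) \<and> wsq r (raise q u) \<le> B * wsq (r + 1) u"
    using zero_le_power[of "2::real" r] by (intro exI[of _ "2 ^ r"]) simp
qed

lemma adj_pair_lower_raise:
  assumes q: "q < N"
  shows "adj_pair N 1 (lower q) (raise q)"
  unfolding adj_pair_def formal_adj_def
  using vinner_lower[OF q] order_le_lower[OF q] order_le_raise[OF q]
  by (auto simp: lower_supp_ok raise_supp_ok lower_Dfin[OF q] raise_Dfin[OF q] Dfin_supp_ok)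
     (metis Dfin_supp_ok cnj_vinner)

lemma lower_lower_commute: "q \<noteq> q' \<Longrightarrow> lower q (lower q' u) = lower q' (lower q u)"
  and raise_raise_commute: "q \<noteq> q' \<Longrightarrow> raise q (raise q' u) = raise q' (raise q u)"
  and lower_raise_commute: "q \<noteq> q' \<Longrightarrow> lower q (raise q' u) = raise q' (lower q u)"
  by (auto simp: fun_eq_iff lower_def raise_def list_update_swap)

text \<open>Adjoints reverse a product; commutation of the \<open>S q\<close> for different modes
  restores the order, so the same list describes both sides.\<close>

lemma adj_pair_foldr:
  assumes "distinct qs"
    and "\<And>q. q \<in> set qs \<Longrightarrow> adj_pair N 1 (T q) (S q)"
    and "\<And>q q' u. q \<in> set qs \<Longrightarrow> q' \<in> set qs \<Longrightarrow> q \<noteq> q' \<Longrightarrow> S q (S q' u) = S q' (S q u)"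
  shows "adj_pair N (length qs) (foldr T qs) (foldr S qs)"
  using assms
proof (induction qs)
  case Nil
  show ?case using adj_pair_id by (simp add: id_def)
next
  case (Cons q qs)
  note comm_S = Cons.prems(3)
  have comm: "foldr S ps (S q u) = S q (foldr S ps u)" if "set ps \<subseteq> set qs" for ps u
    using that
  proof (induction ps)
    case (Cons p ps)
    have "S p (S q w) = S q (S p w)" for w
      using Cons.prems \<open>distinct (q # qs)\<close> by (intro comm_S) auto
    with Cons show ?case by simp
  qed simp
  have "adj_pair N (1 + length qs) (\<lambda>u. T q (foldr T qs u)) (\<lambda>u. foldr S qs (S q u))"
    using Cons by (intro adj_pair_comp Cons.IH) auto
  moreover have "foldr T (q # qs) = (\<lambda>u. T q (foldr T qs u))"
    "foldr S (q # qs) = (\<lambda>u. foldr S qs (S q u))" "length (q # qs) = 1 + length qs"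
    by (simp_all add: fun_eq_iff comm)
  ultimately show ?case by (simp only:)
qed

lemma foldr_comp_id: "foldr (\<circ>) fs id u = foldr (\<lambda>f. f) fs u"
  by (induction fs) auto

section \<open>The regularised weight\<close>

text \<open>The eigenvalue of C_epsilon = C (1 + epsilon C)^(-2) at energy \<open>E\<close>, for C
  the \<open>P\<close>-th power of the energy.\<close>

definition creg :: "nat \<Rightarrow> real \<Rightarrow> real \<Rightarrow> real" where
  "creg P e E = E ^ P / (1 + e * E ^ P)\<^sup>2"

lemma creg_nonneg: "E \<ge> 0 \<Longrightarrow> creg P e E \<ge> 0"
  by (simp add: creg_def)

lemma creg_le_power:
  assumes "E \<ge> 0" "e > 0"
  shows "creg P e E \<le> E ^ P"
proof -
  have "1 \<le> (1 + e * E ^ P)\<^sup>2"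
    using assms by (intro one_le_power) simp
  then show ?thesis
    using assms by (simp add: creg_def divide_le_eq mult_le_cancel_left1 add_pos_nonneg)
qed

lemma creg_le_inverse:
  assumes "E \<ge> 0" "e > 0"
  shows "creg P e E \<le> 1 / e"
proof -
  define z where "z = E ^ P"
  have z: "z \<ge> 0" using assms by (simp add: z_def)
  then have "0 < 1 + e * z" using assms by (simp add: add_pos_nonneg)
  moreover have "z * e \<le> (1 + e * z)\<^sup>2"
    using z assms by (simp add: power2_sum)
  ultimately show ?thesis
    using assms by (simp add: creg_def z_def[symmetric] field_simps)
qed

text \<open>The ratio of the values at \<open>E\<close> and \<open>E + w\<close> lies between \<open>1 / \<rho>\<close> and \<open>\<rho>\<close> with
  \<open>\<rho> = (1 + w / E) ^ P\<close>, so the increment is at most \<open>\<rho> - 1\<close> times the smaller value; by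
  Bernoulli \<open>\<rho> - 1 = O(1 / E)\<close>, which absorbs the occupation number \<open>t\<close>.  None of the constants
  depends on \<open>e\<close>.\<close>

lemma creg_increment:
  assumes e: "e > 0" and w0: "w0 > 0" and w: "0 < w" "w \<le> W" and E: "E = 0 \<or> w0 \<le> E"
    and P: "P \<ge> 1" and t: "t \<ge> 0" "t * w \<le> E + w"
  defines "A \<equiv> real P * (1 + W / w0) ^ P" and "B \<equiv> W ^ P"
  shows "t * \<bar>creg P e (E + w) - creg P e E\<bar> \<le> A * creg P e E + B"
    and "t * \<bar>creg P e (E + w) - creg P e E\<bar> \<le> A * creg P e (E + w) + B"
proof -
  have A: "A \<ge> 0" and B: "B \<ge> 0" using w w0 by (auto simp: A_def B_def)
  have E0: "E \<ge> 0" using E w0 by auto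
  note cn = creg_nonneg[OF E0, of P e] creg_nonneg[of "E + w" P e]
  have "t * \<bar>creg P e (E + w) - creg P e E\<bar> \<le> A * min (creg P e E) (creg P e (E + w)) + B"
  proof (cases "E = 0")
    \<comment> \<open>At the vacuum no ratio is available. Here t <= 1, and the increment is a
      single value of the weight, at most \<open>W ^ P\<close>: the origin of
      \<open>B\<close>.\<close>
    case True
    then have "t \<le> 1" using t(2) w by simp
    have "creg P e w \<le> W ^ P"
      using creg_le_power[of w e P] power_mono[OF w(2), of P] w e by simp
    moreover have "t * creg P e w \<le> 1 * creg P e w"
      using \<open>t \<le> 1\<close> creg_nonneg[of w P e] w by (intro mult_right_mono) auto
    moreover have "creg P e 0 = 0" using P by (simp add: creg_def)
    ultimately show ?thesis
      using True creg_nonneg[of w P e] w by (simp add: B_def)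
  next
    case False
    then have Ep: "E > 0" "w0 \<le> E" using E w0 by auto
    define a b \<rho> where "a = E ^ P" and "b = (E + w) ^ P" and "\<rho> = (1 + w / E) ^ P"
    have a: "a > 0" using Ep by (simp add: a_def)
    have ab: "a \<le> b" unfolding a_def b_def using E0 w by (intro power_mono) auto
    have "E + w = (1 + w / E) * E" using Ep by (simp add: field_simps)
    then have b: "b = \<rho> * a" by (simp add: a_def b_def \<rho>_def power_mult_distrib)
    have r1: "\<rho> \<ge> 1" using Ep w by (simp add: \<rho>_def)
    have pos: "0 < 1 + e * a" "0 < 1 + e * b" using e a ab by (auto intro!: add_pos_pos)
    have c1: "creg P e E = a / (1 + e * a)\<^sup>2" and c2: "creg P e (E + w) = b / (1 + e * b)\<^sup>2"
      by (auto simp: creg_def a_def b_def)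
    have up: "creg P e (E + w) \<le> \<rho> * creg P e E"
    proof -
      have "b / (1 + e * b)\<^sup>2 \<le> b / (1 + e * a)\<^sup>2"
        using pos ab a e by (intro divide_left_mono power_mono mult_pos_pos) auto
      then show ?thesis by (simp add: c1 c2 b)
    qed
    have lo: "creg P e E \<le> \<rho> * creg P e (E + w)"
    proof -
      \<comment> \<open>This says that a / (1 + e a) increases in a. Squaring and cancelling one
        factor a gives the lower ratio bound, since b = \<rho> a.\<close>
      have "a * (1 + e * b) \<le> b * (1 + e * a)" using ab by (simp add: algebra_simps)
      then have "(a * (1 + e * b))\<^sup>2 \<le> (b * (1 + e * a))\<^sup>2"
        using pos a by (intro power_mono) auto
      then have "a\<^sup>2 / (1 + e * a)\<^sup>2 \<le> b\<^sup>2 / (1 + e * b)\<^sup>2"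
        using pos by (simp add: divide_le_eq le_divide_eq power_mult_distrib mult.commute)
      then have "a * (a / (1 + e * a)\<^sup>2) \<le> a * (\<rho> * (b / (1 + e * b)\<^sup>2))"
        by (simp add: b power2_eq_square mult_ac)
      then show ?thesis unfolding c1 c2 by (rule mult_left_le_imp_le[OF _ a])
    qed
    have d: "\<bar>creg P e (E + w) - creg P e E\<bar> \<le> (\<rho> - 1) * min (creg P e E) (creg P e (E + w))"
      using up lo by (auto simp: min_def abs_if algebra_simps)
    define s where "s = 1 + w / E"
    have s: "s \<ge> 1" using Ep w by (simp add: s_def)
    \<comment> \<open>Bernoulli is applied to 1 / s rather than to s, because 1 - 1 / s = w / (E +
      w) is exactly what the hypothesis \<open>t * w \<le> E + w\<close> cancels.\<close>
    have "1 + real P * (1 / s - 1) \<le> (1 + (1 / s - 1)) ^ P"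
      using s by (intro Bernoulli_inequality) auto
    then have "1 - (1 / s) ^ P \<le> real P * (1 - 1 / s)"
      by (simp add: algebra_simps)
    then have "s ^ P * (1 - (1 / s) ^ P) \<le> s ^ P * (real P * (1 - 1 / s))"
      using s by (intro mult_left_mono) auto
    then have r: "\<rho> - 1 \<le> s ^ P * (real P * (1 - 1 / s))"
      using s by (simp add: \<rho>_def s_def[symmetric] right_diff_distrib power_divide)
    have ss: "1 - 1 / s = w / (E + w)"
      using Ep w by (simp add: s_def field_simps)
    have "t * (\<rho> - 1) \<le> t * (s ^ P * (real P * (w / (E + w))))"
      using r t unfolding ss by (intro mult_left_mono) auto
    also have "\<dots> = (t * w / (E + w)) * (real P * s ^ P)" by simp
    also have "\<dots> \<le> 1 * (real P * s ^ P)"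
      using t Ep w s by (intro mult_right_mono) auto
    also have "s ^ P \<le> (1 + W / w0) ^ P"
      unfolding s_def using Ep w w0 by (intro power_mono add_mono frac_le) auto
    finally have tr: "t * (\<rho> - 1) \<le> A" by (simp add: A_def mult_left_mono)
    have "t * \<bar>creg P e (E + w) - creg P e E\<bar>
        \<le> (t * (\<rho> - 1)) * min (creg P e E) (creg P e (E + w))"
      using mult_left_mono[OF d t(1)] by (simp add: mult.assoc)
    also have "\<dots> \<le> A * min (creg P e E) (creg P e (E + w))"
      using tr cn w E0 by (intro mult_right_mono) auto
    finally show ?thesis using B by simp
  qed
  then show "t * \<bar>creg P e (E + w) - creg P e E\<bar> \<le> A * creg P e E + B"
    and "t * \<bar>creg P e (E + w) - creg P e E\<bar> \<le> A * creg P e (E + w) + B"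
    using A mult_left_mono[OF min.cobounded1 A, of "creg P e E" "creg P e (E + w)"]
      mult_left_mono[OF min.cobounded2 A, of "creg P e E" "creg P e (E + w)"]
    by linarith+
qed

lemma one_plus_power_le:
  fixes y :: real
  assumes "y \<ge> 0" "k \<le> l"
  shows "(1 + y) ^ k \<le> 2 ^ k * (1 + y ^ l)"
proof (cases "y \<le> 1")
  case True
  then have "(1 + y) ^ k \<le> 2 ^ k * 1" using assms power_mono[of "1 + y" 2 k] by simp
  also have "\<dots> \<le> 2 ^ k * (1 + y ^ l)" using assms by (intro mult_left_mono) auto
  finally show ?thesis .
next
  case False
  then have "(1 + y) ^ k \<le> (2 * y) ^ k" by (intro power_mono) auto
  also have "\<dots> = 2 ^ k * y ^ k" by (simp add: power_mult_distrib)
  also have "\<dots> \<le> 2 ^ k * (1 + y ^ l)"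
    using False by (intro mult_left_mono add_increasing power_increasing[OF assms(2)]) auto
  finally show ?thesis .
qed

section \<open>The bosonic model\<close>

locale boson =
  fixes n m :: nat and ws wp :: "nat \<Rightarrow> real"
  assumes n: "n \<ge> 1" and m: "m \<ge> 1"
    and ws: "\<And>k. k < n \<Longrightarrow> ws k > 0" and wp: "\<And>j. j < m \<Longrightarrow> wp j > 0"
    and resonance: "(\<Sum>k<n. ws k) = (\<Sum>j<m. wp j)"
begin

abbreviation N :: nat where "N \<equiv> n + m"
abbreviation E :: "nat list \<Rightarrow> real" where "E \<equiv> energy n m ws wp"

text \<open>Modes are numbered by their position in the list, so that one argument serves both
  groups.\<close>

definition freq :: "nat \<Rightarrow> real" where
  "freq q = (if q < n then ws q else wp (q - n))"

lemma freq_pos: "q < N \<Longrightarrow> freq q > 0"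
  using ws wp by (auto simp: freq_def)

lemma sum_modes: "(\<Sum>q<N. f q) = (\<Sum>q<n. f q) + (\<Sum>j<m. f (n + j))"
  for f :: "nat \<Rightarrow> real"
  by (induction m) auto

lemma energy_freq: "E x = (\<Sum>q<N. freq q * real (x ! q))"
  unfolding sum_modes energy_def by (simp add: freq_def)

text \<open>\<open>W\<close> serves as a common upper bound of the frequencies; \<open>w0\<close>
  bounds from below the gap between the vacuum and all other energies.\<close>

definition W :: real where "W = (\<Sum>q<N. freq q)"
definition w0 :: real where "w0 = Min (freq ` {..<N})"

lemma freq_le_W: "q < N \<Longrightarrow> freq q \<le> W"
  unfolding W_def using freq_pos by (intro member_le_sum) (auto intro: less_imp_le)

lemma w0_le_freq: "q < N \<Longrightarrow> w0 \<le> freq q"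
  unfolding w0_def by (intro Min_le) auto

lemma w0_pos: "w0 > 0"
proof -
  have "freq ` {..<N} \<noteq> {}" using n by auto
  then show ?thesis
    unfolding w0_def using freq_pos by (subst Min_gr_iff) auto
qed

lemma W_pos: "W > 0"
  using freq_le_W[of 0] freq_pos[of 0] n by auto

lemma energy_nonneg: "E x \<ge> 0"
  unfolding energy_freq by (intro sum_nonneg mult_nonneg_nonneg less_imp_le[OF freq_pos]) auto

lemma freq_mult_le_energy: "q < N \<Longrightarrow> freq q * real (x ! q) \<le> E x"
  unfolding energy_freq
  by (intro member_le_sum[where f = "\<lambda>q. freq q * real (x ! q)"] mult_nonneg_nonneg
      less_imp_le[OF freq_pos]) auto

lemma energy_gap: "E x = 0 \<or> w0 \<le> E x"
proof (cases "\<exists>q<N. x ! q \<noteq> 0")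
  case True
  then obtain q where q: "q < N" "x ! q \<noteq> 0" by blast
  then have "freq q * 1 \<le> freq q * real (x ! q)"
    using freq_pos[OF q(1)] by (intro mult_left_mono) auto
  then show ?thesis
    using freq_mult_le_energy[OF q(1), of x] w0_le_freq[OF q(1)] by linarith
qed (auto simp: energy_freq)

lemma energy_up:
  assumes "q < N" "length x = N"
  shows "E (x[q := x ! q + 1]) = E x + freq q"
proof -
  have "E (x[q := x ! q + 1]) = (\<Sum>i<N. freq i * real (x ! i) + (if i = q then freq q else 0))"
    unfolding energy_freq using assms by (intro sum.cong) (auto simp: nth_list_update algebra_simps)
  then show ?thesis
    using assms(1) by (simp add: energy_freq sum.distrib)
qed

lemma energy_down:
  assumes "q < N" "length x = N" "x ! q \<noteq> 0"
  shows "E x = E (x[q := x ! q - 1]) + freq q"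
  using energy_up[of q "x[q := x ! q - 1]"] assms by simp

lemma
  assumes "length x = N"
  shows energy_le_wgt: "E x \<le> W * wgt x" and wgt_le_energy: "wgt x \<le> 1 + E x / w0"
proof -
  have s: "real (sum_list x) = (\<Sum>q<N. real (x ! q))"
    using assms by (simp add: sum_list_sum_nth atLeast0LessThan)
  have "E x \<le> (\<Sum>q<N. W * real (x ! q))"
    unfolding energy_freq by (intro sum_mono mult_right_mono freq_le_W) auto
  also have "\<dots> \<le> W * wgt x"
    using W_pos by (simp add: wgt_def s flip: sum_distrib_left)
  finally show "E x \<le> W * wgt x" .
  have "w0 * real (sum_list x) \<le> E x"
    unfolding energy_freq s sum_distrib_left by (intro sum_mono mult_right_mono w0_le_freq) auto
  then show "wgt x \<le> 1 + E x / w0"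
    using w0_pos by (simp add: wgt_def field_simps)
qed

lemma wgt_power_le:
  assumes "length x = N"
  shows "wgt x ^ N \<le> 2 ^ N * (1 + E x ^ (2 * N) / w0 ^ (2 * N))"
proof -
  have "wgt x ^ N \<le> (1 + E x / w0) ^ N"
    using wgt_le_energy[OF assms] wgt_ge_1[of x] by (intro power_mono) auto
  also have "\<dots> \<le> 2 ^ N * (1 + (E x / w0) ^ (2 * N))"
    using energy_nonneg[of x] w0_pos by (intro one_plus_power_le) auto
  finally show ?thesis by (simp add: power_divide)
qed

text \<open>The domain controls E^(2N) |u|^2, so the weight power N that operators of order N
  require follows with room to spare.\<close>

lemma Chalf_dom_wsummable:
  assumes "u \<in> Chalf_dom n m ws wp"
  shows "supp_ok N u" "wsummable N u"
proof -
  have u: "ell2 N u" and Eu: "ell2 N (\<lambda>x. complex_of_real (E x ^ N) * u x)"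
    using assms by (auto simp: Chalf_dom_def)
  show su: "supp_ok N u" using u by (rule ell2_supp_ok)
  have s: "(\<lambda>x. 2 ^ N * ((cmod (u x))\<^sup>2 + 1 / w0 ^ (2 * N) * (cmod (complex_of_real (E x ^ N) * u x))\<^sup>2))
      summable_on UNIV"
    using u Eu unfolding ell2_def by (intro summable_on_cmult_right summable_on_add) auto
  have "wgt x ^ N * (cmod (u x))\<^sup>2
      \<le> 1 * (2 ^ N * ((cmod (u x))\<^sup>2 + 1 / w0 ^ (2 * N) * (cmod (complex_of_real (E x ^ N) * u x))\<^sup>2))" for x
  proof (cases "length x = N")
    case True
    have "cmod (complex_of_real (E x ^ N) * u x) = E x ^ N * cmod (u x)"
      using energy_nonneg[of x] by (simp add: norm_mult norm_power)
    then have "(cmod (complex_of_real (E x ^ N) * u x))\<^sup>2 = E x ^ (2 * N) * (cmod (u x))\<^sup>2"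
      by (simp add: power_mult_distrib flip: power_mult) (simp add: mult.commute)
    then show ?thesis
      using mult_right_mono[OF wgt_power_le[OF True], of "(cmod (u x))\<^sup>2"]
      by (simp add: algebra_simps)
  qed (use su in \<open>simp add: supp_ok_def\<close>)
  note c = nonneg_comparison(1)[OF s _ this]
  show "wsummable N u"
    unfolding wsummable_def by (rule c) (use wgt_ge_1 in \<open>auto simp: order_trans[OF zero_le_one]\<close>)
qed

text \<open>With z = E^(2N) the square splits as z/(1+ez) times 1/(1+ez): the second factor pays for
  the weight, which grows at most like 1 + Kz, and the first is at most 1/e. The bound blows up as e
  tends to 0, which (a) permits since it fixes epsilon.\<close>

lemma wgt_Ceps_half_bounded:
  assumes e: "e > 0" and x: "length x = N"
  shows "wgt x ^ N * (E x ^ N / (1 + e * E x ^ (2 * N)))\<^sup>2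
      \<le> 2 ^ N * ((1 + 1 / (w0 ^ (2 * N) * e)) / e)"
proof -
  define z K where "z = E x ^ (2 * N)" and "K = 1 / w0 ^ (2 * N)"
  have z: "z \<ge> 0" and K: "K \<ge> 0" using energy_nonneg[of x] w0_pos by (auto simp: z_def K_def)
  have pos: "0 < 1 + e * z" using e z by (simp add: add_pos_nonneg)
  have "(E x ^ N / (1 + e * z))\<^sup>2 = z / (1 + e * z) * (1 / (1 + e * z))"
    by (simp add: z_def power_divide power2_eq_square mult_2 power_add)
  moreover have "wgt x ^ N \<le> 2 ^ N * (1 + K * z)"
    using wgt_power_le[OF x] by (simp add: z_def K_def)
  ultimately have "wgt x ^ N * (E x ^ N / (1 + e * z))\<^sup>2
      \<le> 2 ^ N * (1 + K * z) * (z / (1 + e * z) * (1 / (1 + e * z)))"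
    using z pos by (simp only:) (intro mult_right_mono, auto)
  also have "\<dots> = 2 ^ N * (((1 + K * z) / (1 + e * z)) * (z / (1 + e * z)))" by simp
  also have "\<dots> \<le> 2 ^ N * ((1 + K / e) * (1 / e))"
  proof (intro mult_left_mono mult_mono)
    have "(1 + K / e) * (1 + e * z) = 1 + K * z + (K / e + e * z)"
      using e by (simp add: field_simps)
    moreover have "K / e + e * z \<ge> 0" using K e z by simp
    ultimately show "(1 + K * z) / (1 + e * z) \<le> 1 + K / e"
      using pos by (simp add: divide_le_eq)
    show "z / (1 + e * z) \<le> 1 / e" using pos e by (simp add: field_simps)
  qed (use K e z pos in auto)
  finally show ?thesis by (simp add: z_def K_def)
qed

subsection \<open>The interaction\<close>

lemma lower_energy:
  assumes "q < N" "supp_ok N u"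
  shows "lower q (\<lambda>x. \<phi> (E x) * u x) = (\<lambda>x. \<phi> (E x + freq q) * lower q u x)"
proof
  fix x
  show "lower q (\<lambda>x. \<phi> (E x) * u x) x = \<phi> (E x + freq q) * lower q u x"
    using energy_up[OF assms(1), of x] assms(2)
    by (cases "length x = N") (auto simp: lower_def supp_ok_def)
qed

text \<open>At x ! q = 0 both sides vanish, so the shifted argument matters only where the energy is
  at least \<open>freq q\<close>.\<close>

lemma raise_energy:
  assumes "q < N" "supp_ok N u"
  shows "raise q (\<lambda>x. \<phi> (E x) * u x) = (\<lambda>x. \<phi> (E x - freq q) * raise q u x)"
proof
  fix x
  show "raise q (\<lambda>x. \<phi> (E x) * u x) x = \<phi> (E x - freq q) * raise q u x"
    using energy_down[OF assms(1), of x] assms(2)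
    by (cases "length x = N") (auto simp: raise_def supp_ok_def)
qed

definition ladder :: "bool \<Rightarrow> nat \<Rightarrow> vec \<Rightarrow> vec" where
  "ladder b q = (if b then raise q else lower q)"

lemma adj_pair_ladder: "q < N \<Longrightarrow> adj_pair N 1 (ladder b q) (ladder (\<not> b) q)"
  using adj_pair_lower_raise[of q N] adj_pair_sym[OF adj_pair_lower_raise[of q N]]
  by (simp add: ladder_def)

lemma ladder_commute: "q \<noteq> q' \<Longrightarrow> ladder b q (ladder b' q' u) = ladder b' q' (ladder b q u)"
  by (simp add: ladder_def lower_lower_commute raise_raise_commute lower_raise_commute)

lemma ladder_energy:
  assumes "q < N" "supp_ok N u"
  shows "ladder b q (\<lambda>x. \<phi> (E x) * u x)
    = (\<lambda>x. \<phi> (E x + (if b then - freq q else freq q)) * ladder b q u x)"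
  using lower_energy[OF assms] raise_energy[OF assms] by (simp add: ladder_def)

text \<open>A product with exactly one ladder operator per mode, creating where \<open>b\<close>
  holds. Both terms of I have this shape, and negating \<open>b\<close> gives the formal
  adjoint.\<close>

definition pump :: "(nat \<Rightarrow> bool) \<Rightarrow> vec \<Rightarrow> vec" where
  "pump b = foldr (\<lambda>q. ladder (b q) q) [0..<N]"

lemma adj_pair_pump: "adj_pair N N (pump b) (pump (\<lambda>q. \<not> b q))"
proof -
  have "adj_pair N (length [0..<N]) (pump b) (pump (\<lambda>q. \<not> b q))"
    unfolding pump_def by (intro adj_pair_foldr adj_pair_ladder ladder_commute) auto
  then show ?thesis by simp
qed

lemma foldr_ladder_energy:
  assumes "supp_ok N u" "set qs \<subseteq> {..<N}"
  shows "supp_ok N (foldr (\<lambda>q. ladder (b q) q) qs u) \<and>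
    foldr (\<lambda>q. ladder (b q) q) qs (\<lambda>x. \<phi> (E x) * u x)
    = (\<lambda>x. \<phi> (E x + (\<Sum>q\<leftarrow>qs. if b q then - freq q else freq q))
        * foldr (\<lambda>q. ladder (b q) q) qs u x)"
  using assms(2)
proof (induction qs arbitrary: \<phi>)
  case Nil
  then show ?case using assms(1) by simp
next
  case (Cons q qs)
  let ?G = "foldr (\<lambda>q. ladder (b q) q) qs"
  let ?s = "\<Sum>q\<leftarrow>qs. if b q then - freq q else freq q"
  have q: "q < N" and s: "supp_ok N (?G u)"
    and G: "?G (\<lambda>x. \<phi> (E x) * u x) = (\<lambda>x. (\<lambda>y. \<phi> (y + ?s)) (E x) * ?G u x)"
    using Cons by auto
  have "ladder (b q) q (?G (\<lambda>x. \<phi> (E x) * u x))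
      = (\<lambda>x. \<phi> (E x + (if b q then - freq q else freq q) + ?s) * ladder (b q) q (?G u) x)"
    unfolding G by (rule ladder_energy[OF q s])
  moreover have "supp_ok N (ladder (b q) q (?G u))"
    using s by (simp add: ladder_def lower_supp_ok raise_supp_ok)
  ultimately show ?case
    by (simp add: add.assoc)
qed

lemma pump_energy:
  assumes "supp_ok N u" "(\<Sum>q<N. if b q then - freq q else freq q) = 0"
  shows "pump b (\<lambda>x. \<phi> (E x) * u x) = (\<lambda>x. \<phi> (E x) * pump b u x)"
proof -
  have "(\<Sum>q\<leftarrow>[0..<N]. if b q then - freq q else freq q) = 0"
    using assms(2) by (simp add: sum_list_distinct_conv_sum_set atLeast0LessThan)
  then show ?thesis
    using foldr_ladder_energy[OF assms(1), of "[0..<N]" b \<phi>] unfolding pump_def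
    by (simp add: atLeast0LessThan)
qed

lemma Iop_pump: "Iop n m u = (\<lambda>x. pump (\<lambda>q. q < n) u x - pump (\<lambda>q. \<not> q < n) u x)"
proof -
  have a: "[0..<N] = [0..<n] @ [n..<N]"
    using upt_add_eq_append[of 0 n m] by simp
  have "map (\<lambda>q. ladder (q < n) q) [0..<N] = map raise [0..<n] @ map lower [n..<N]"
    "map (\<lambda>q. ladder (\<not> q < n) q) [0..<N] = map lower [0..<n] @ map raise [n..<N]"
    unfolding a by (auto simp: ladder_def)
  moreover have "pump b u = foldr (\<lambda>f. f) (map (\<lambda>q. ladder (b q) q) [0..<N]) u" for b
    by (simp add: pump_def foldr_map comp_def)
  ultimately show ?thesis by (simp only: Iop_def foldr_comp_id)
qed

text \<open>The two terms of I are formal adjoints of each other and carry opposite signs, so I is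
  formally skew; its order is the number of ladder factors.\<close>

lemma adj_pair_Iop: "adj_pair N N (Iop n m) (\<lambda>u x. - Iop n m u x)"
  using adj_pair_add[OF adj_pair_pump[of "\<lambda>q. q < n"] adj_pair_uminus[OF adj_pair_pump[of "\<lambda>q. \<not> q < n"]]]
  unfolding Iop_pump by simp

text \<open>Each term of I trades one quantum in every mode of one group for one in every mode of
  the other. By resonance the net energy transfer is 0, so any function of the energy passes
  through.\<close>

lemma Iop_energy:
  assumes "supp_ok N u"
  shows "Iop n m (\<lambda>x. \<phi> (E x) * u x) = (\<lambda>x. \<phi> (E x) * Iop n m u x)"
proof -
  have "(\<Sum>q<N. if q < n then - freq q else freq q) = 0"
    "(\<Sum>q<N. if \<not> q < n then - freq q else freq q) = 0"
    unfolding sum_modes using resonance by (simp_all add: freq_def sum_negf)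
  then show ?thesis
    unfolding Iop_pump by (simp add: pump_energy[OF assms] right_diff_distrib)
qed

subsection \<open>Commutators with the regularised weight\<close>

definition cw :: "real \<Rightarrow> nat list \<Rightarrow> real" where
  "cw e x = creg (2 * N) e (E x)"

text \<open>The constants \<open>A\<close> and \<open>B\<close> of \<open>creg_increment\<close> at
  P = 2N, with the bounds \<open>W\<close> and \<open>w0\<close> common to all modes.\<close>

definition cA :: real where "cA = real (2 * N) * (1 + W / w0) ^ (2 * N)"
definition cB :: real where "cB = W ^ (2 * N)"

text \<open>The quadratic form of cA C_epsilon + cB. All increment estimates end in it, and
  \<open>Q_split\<close> turns it into the two terms on the right of (b).\<close>

definition Q :: "real \<Rightarrow> vec \<Rightarrow> real" where
  "Q e u = (\<Sum>\<^sub>\<infinity>x. (cA * cw e x + cB) * (cmod (u x))\<^sup>2)"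

lemma cA_nonneg: "cA \<ge> 0" and cB_nonneg: "cB \<ge> 0"
  using W_pos w0_pos by (auto simp: cA_def cB_def)

lemma Ceps_cw: "Ceps n m ws wp e u = (\<lambda>x. complex_of_real (cw e x) * u x)"
  by (simp add: Ceps_def cw_def creg_def)

lemma cw_nonneg: "cw e x \<ge> 0"
  by (simp add: cw_def creg_nonneg energy_nonneg)

lemma cw_bounded: "e > 0 \<Longrightarrow> cw e x \<le> 1 / e"
  by (simp add: cw_def creg_le_inverse energy_nonneg del: One_nat_def)

lemma norm_cw_bounded: "e > 0 \<Longrightarrow> cmod (complex_of_real (cw e x)) \<le> 1 / e"
  using cw_bounded[of e x] cw_nonneg[of e x] by simp

lemma weight_nonneg: "0 \<le> cA * cw e x + cB"
  using cA_nonneg cB_nonneg cw_nonneg by simp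

lemma weight_bounded:
  assumes "e > 0"
  shows "\<bar>cA * cw e x + cB\<bar> \<le> cA * (1 / e) + cB"
  using weight_nonneg[of e x] mult_left_mono[OF cw_bounded[OF assms] cA_nonneg, of x] by linarith

lemma Q_nonneg: "Q e u \<ge> 0"
  unfolding Q_def by (intro infsum_nonneg mult_nonneg_nonneg weight_nonneg) simp

lemma summable_on_Q:
  "ell2 N u \<Longrightarrow> e > 0 \<Longrightarrow> (\<lambda>x. (cA * cw e x + cB) * (cmod (u x))\<^sup>2) summable_on UNIV"
  by (rule summable_on_bounded_diag[OF _ weight_bounded])

lemma summable_on_cw:
  "ell2 N u \<Longrightarrow> e > 0 \<Longrightarrow> (\<lambda>x. cw e x * (cmod (u x))\<^sup>2) summable_on UNIV"
  by (rule summable_on_bounded_diag[of _ _ _ "1 / e"]) (auto simp: cw_nonneg cw_bounded)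

lemma Q_split:
  assumes u: "ell2 N u" and e: "e > 0"
  shows "Q e u = cA * (\<Sum>\<^sub>\<infinity>x. cw e x * (cmod (u x))\<^sup>2) + cB * (vnorm u)\<^sup>2"
proof -
  have s: "(\<lambda>x. (cmod (u x))\<^sup>2) summable_on UNIV" using u by (simp add: ell2_def)
  have "Q e u = (\<Sum>\<^sub>\<infinity>x. cA * (cw e x * (cmod (u x))\<^sup>2) + cB * (cmod (u x))\<^sup>2)"
    by (simp add: Q_def algebra_simps)
  also have "\<dots> = (\<Sum>\<^sub>\<infinity>x. cA * (cw e x * (cmod (u x))\<^sup>2)) + (\<Sum>\<^sub>\<infinity>x. cB * (cmod (u x))\<^sup>2)"
    by (intro infsum_add summable_on_cmult_right summable_on_cw[OF u e] s)
  finally show ?thesis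
    by (simp add: infsum_cmult_right' vnorm_sq)
qed

lemma cw_increment:
  assumes e: "e > 0" and q: "q < N" and x: "length x = N"
  shows "(real (x ! q) + 1) * \<bar>cw e (x[q := x ! q + 1]) - cw e x\<bar> \<le> cA * cw e x + cB"
    and "(real (x ! q) + 1) * \<bar>cw e (x[q := x ! q + 1]) - cw e x\<bar>
      \<le> cA * cw e (x[q := x ! q + 1]) + cB"
proof -
  have t: "(real (x ! q) + 1) * freq q \<le> E x + freq q"
    using freq_mult_le_energy[OF q, of x] by (simp add: algebra_simps)
  have P: "1 \<le> 2 * N" using n by simp
  note c = creg_increment[OF e w0_pos freq_pos[OF q] freq_le_W[OF q] energy_gap P _ t]
  show "(real (x ! q) + 1) * \<bar>cw e (x[q := x ! q + 1]) - cw e x\<bar> \<le> cA * cw e x + cB"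
    unfolding cw_def energy_up[OF q x] cA_def cB_def by (rule c(1)) simp
  show "(real (x ! q) + 1) * \<bar>cw e (x[q := x ! q + 1]) - cw e x\<bar>
      \<le> cA * cw e (x[q := x ! q + 1]) + cB"
    unfolding cw_def energy_up[OF q x] cA_def cB_def by (rule c(2)) simp
qed

text \<open>The commutator of C_epsilon with \<open>lower q\<close> couples x only to x + delta_q,
  with coefficient sqrt(x_q + 1) times an increment of the weight. After the arithmetic-geometric
  inequality |u|^2 sits at x and |v|^2 at x + delta_q, which is why the increment must be bounded by
  the weight at either end. With \<open>raise q u\<close> and \<open>lower q v\<close> in l2 both
  series converge, and no approximation enters.\<close>

lemma lower_commutator_bound:
  assumes e: "e > 0" and q: "q < N" and u: "ell2 N u" and v: "ell2 N v"
    and ru: "ell2 N (raise q u)" and lv: "ell2 N (lower q v)"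
  shows "cmod (vinner u (\<lambda>x. complex_of_real (cw e x) * lower q v x)
      - vinner (raise q u) (\<lambda>x. complex_of_real (cw e x) * v x)) \<le> (Q e u + Q e v) / 2"
proof -
  let ?C = "\<lambda>(w :: vec) x. complex_of_real (cw e x) * w x"
  note su = ell2_supp_ok[OF u] and sv = ell2_supp_ok[OF v]
  have Cb: "ell2 N (?C w)" if "ell2 N w" for w
    by (rule ell2_bounded_mult[OF that norm_cw_bounded[OF e]])
  let ?f1 = "\<lambda>x. cnj (u x) * ?C (lower q v) x" and ?f2 = "\<lambda>x. cnj (u x) * lower q (?C v) x"
  have s1: "?f1 summable_on UNIV"
    by (rule summable_on_vinner[OF u Cb[OF lv]])
  have s2: "?f2 summable_on UNIV"
    using summable_on_vinner[OF ru Cb[OF v]]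
      summable_on_vinner_lower[OF q supp_ok_mult[OF sv] su, of "\<lambda>x. complex_of_real (cw e x)"]
    by blast
  have "vinner (raise q u) (?C v) = vinner u (lower q (?C v))"
    by (rule vinner_lower[OF q supp_ok_mult[OF sv] su, symmetric])
  then have d: "vinner u (?C (lower q v)) - vinner (raise q u) (?C v) = (\<Sum>\<^sub>\<infinity>x. ?f1 x - ?f2 x)"
    unfolding vinner_def by (simp only: infsum_diff[OF s1 s2])
  let ?a = "\<lambda>x. (cA * cw e x + cB) * (cmod (u x))\<^sup>2"
  let ?b = "\<lambda>y. (cA * cw e y + cB) * (cmod (v y))\<^sup>2"
  \<comment> \<open>Lists with y ! q = 0 lie outside the image of the shift; dropping these
    nonnegative terms leaves at most \<open>Q e v\<close>.\<close>
  let ?h = "\<lambda>y. if y ! q = 0 then 0 else ?b y"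
  let ?b' = "\<lambda>x. (cA * cw e (x[q := x ! q + 1]) + cB) * (cmod (v (x[q := x ! q + 1])))\<^sup>2"
  have hb: "0 \<le> ?h y" "?h y \<le> 1 * ?b y" for y
    using weight_nonneg[of e] by auto
  note h = nonneg_comparison[OF summable_on_Q[OF v e] hb]
  have z1: "?b' x = 0" if "length x \<noteq> N" for x using that sv by (simp add: supp_ok_def)
  have z2: "?h y = 0" if "length y \<noteq> N \<or> y ! q = 0" for y using that sv by (auto simp: supp_ok_def)
  have z3: "?b' x = ?h (x[q := x ! q + 1])" if "length x = N" for x using that q by simp
  have b': "?b' summable_on UNIV \<longleftrightarrow> ?h summable_on UNIV"
    by (rule summable_on_shift[OF q]) (fact z1, fact z2, fact z3)
  have ib': "infsum ?b' UNIV = infsum ?h UNIV"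
    by (rule infsum_shift[OF q]) (fact z1, fact z2, fact z3)
  have pw: "cmod (?f1 x - ?f2 x) \<le> (?a x + ?b' x) * (1 / 2)" for x
  proof (cases "length x = N")
    case True
    let ?y = "x[q := x ! q + 1]"
    define D where "D = (real (x ! q) + 1) * \<bar>cw e ?y - cw e x\<bar>"
    have D: "D \<le> cA * cw e x + cB" "D \<le> cA * cw e ?y + cB" "D \<ge> 0"
      using cw_increment[OF e q True] by (auto simp: D_def)
    have "?f1 x - ?f2 x
        = cnj (u x) * (complex_of_real (sqrt (real (x ! q + 1)) * (cw e x - cw e ?y)) * v ?y)"
      by (simp add: lower_def algebra_simps)
    then have "cmod (?f1 x - ?f2 x)
        = (sqrt (real (x ! q + 1)) * \<bar>cw e x - cw e ?y\<bar>) * (cmod (u x) * cmod (v ?y))"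
      by (simp only: norm_mult complex_mod_cnj norm_of_real abs_mult) simp
    also have "\<dots> \<le> D * (cmod (u x) * cmod (v ?y))"
    proof (intro mult_right_mono)
      \<comment> \<open>The radicand is at least 1, so the root may be replaced by the full
        occupation number, for which the increment bound is stated.\<close>
      have "sqrt (real (x ! q + 1)) \<le> real (x ! q + 1)"
        by (intro real_le_lsqrt) (auto simp: power2_eq_square)
      then show "sqrt (real (x ! q + 1)) * \<bar>cw e x - cw e ?y\<bar> \<le> D"
        unfolding D_def by (auto simp: abs_minus_commute add_ac intro!: mult_right_mono)
    qed auto
    also have "\<dots> \<le> D * (((cmod (u x))\<^sup>2 + (cmod (v ?y))\<^sup>2) * (1 / 2))"
      using sum_squares_bound[of "cmod (u x)" "cmod (v ?y)"] D(3) by (intro mult_left_mono) auto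
    also have "\<dots> = (D * (cmod (u x))\<^sup>2 + D * (cmod (v ?y))\<^sup>2) * (1 / 2)"
      by (simp add: algebra_simps)
    also have "\<dots> \<le> (?a x + ?b' x) * (1 / 2)"
      by (intro mult_right_mono add_mono D) auto
    finally show ?thesis .
  next
    case False
    then have "u x = 0" using su by (simp add: supp_ok_def)
    then show ?thesis using weight_nonneg[of e] by simp
  qed
  have sab: "(\<lambda>x. (?a x + ?b' x) * (1 / 2)) summable_on UNIV"
    using b' h(1) by (intro summable_on_cmult_left summable_on_add summable_on_Q[OF u e]) blast
  have "cmod (\<Sum>\<^sub>\<infinity>x. ?f1 x - ?f2 x) \<le> (\<Sum>\<^sub>\<infinity>x. (?a x + ?b' x) * (1 / 2))"
    by (rule norm_infsum_le[OF has_sum_infsum has_sum_infsum[OF sab] pw])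
       (intro summable_on_diff s1 s2)
  also have "\<dots> = (infsum ?a UNIV + infsum ?b' UNIV) * (1 / 2)"
    using b' h(1) summable_on_Q[OF u e] by (simp only: infsum_cmult_left' infsum_add)
  also have "\<dots> \<le> (Q e u + Q e v) / 2"
    using h(2) unfolding ib' by (simp add: Q_def)
  finally show ?thesis
    unfolding d .
qed

text \<open>The creation case is the complex conjugate of the annihilation case with
  \<open>u\<close> and \<open>v\<close> exchanged.\<close>

lemma ladder_commutator_bound:
  assumes e: "e > 0" and q: "q < N" and u: "ell2 N u" and v: "ell2 N v"
    and lu: "ell2 N (ladder (\<not> b) q u)" and lv: "ell2 N (ladder b q v)"
  shows "cmod (vinner u (\<lambda>x. complex_of_real (cw e x) * ladder b q v x)
      - vinner (ladder (\<not> b) q u) (\<lambda>x. complex_of_real (cw e x) * v x)) \<le> (Q e u + Q e v) / 2"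
proof (cases b)
  case False
  then show ?thesis
    using lower_commutator_bound[OF e q u v] lu lv by (simp add: ladder_def)
next
  case True
  let ?C = "\<lambda>(w :: vec) x. complex_of_real (cw e x) * w x"
  have c: "vinner a (?C b) = cnj (vinner b (?C a))" for a b
    by (metis cnj_vinner vinner_real_mult_left)
  have "cmod (vinner v (?C (lower q u)) - vinner (raise q v) (?C u)) \<le> (Q e v + Q e u) / 2"
    using lower_commutator_bound[OF e q v u] lu lv True by (simp add: ladder_def)
  then have "cmod (cnj (vinner (lower q u) (?C v)) - cnj (vinner u (?C (raise q v)))) \<le> (Q e v + Q e u) / 2"
    unfolding c[of v] c[of "raise q v"] .
  then show ?thesis
    using True by (simp add: ladder_def norm_minus_commute add.commute flip: complex_cnj_diff)
qed

text \<open>A ladder operator L changes one occupation number and its adjoint restores it, so L* C L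
  and C L* L are both diagonal. Their difference \<theta> is an occupation number, plus one for
  creation, times an increment of the weight.\<close>

lemma ladder_diag:
  assumes e: "e > 0" and q: "q < N"
  obtains \<theta> where "\<And>x. \<theta> x \<le> cA * cw e x + cB" "\<exists>M. \<forall>x. \<bar>\<theta> x\<bar> \<le> M" "\<And>u. supp_ok N u \<Longrightarrow>
     (\<lambda>x. ladder (\<not> b) q (\<lambda>y. complex_of_real (cw e y) * ladder b q u y) x)
     = (\<lambda>x. complex_of_real (cw e x) * ladder (\<not> b) q (ladder b q u) x + complex_of_real (\<theta> x) * u x)"
proof -
  define \<theta> where "\<theta> x = (if length x \<noteq> N then 0 else if b
      then (real (x ! q) + 1) * (cw e (x[q := x ! q + 1]) - cw e x)
      else real (x ! q) * (cw e (x[q := x ! q - 1]) - cw e x))" for x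
  have ab: "\<bar>\<theta> x\<bar> \<le> cA * cw e x + cB" for x
  proof (cases "length x = N")
    case True
    \<comment> \<open>For annihilation the increment runs from x - delta_q up to x, so the bound
      relative to the upper end is applied at this list; its factor is (x_q - 1) + 1.\<close>
    then have l: "length (x[q := x ! q - 1]) = N" by simp
    show ?thesis
      using cw_increment(1)[OF e q True] cw_increment(2)[OF e q l] True q weight_nonneg[of e x]
      by (cases "x ! q = 0") (auto simp: \<theta>_def abs_mult abs_minus_commute)
  qed (simp add: \<theta>_def weight_nonneg)
  have e1: "ladder (\<not> b) q (\<lambda>y. complex_of_real (cw e y) * ladder b q u y) x
     = complex_of_real (cw e x) * ladder (\<not> b) q (ladder b q u) x + complex_of_real (\<theta> x) * u x"
    if "supp_ok N u" for u x
  proof (cases "length x = N")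
    case True
    have r: "complex_of_real (sqrt (real k)) * complex_of_real (sqrt (real k)) = of_nat k" for k
      by (simp flip: of_real_mult)
    show ?thesis
    proof (cases b)
      case b: True
      have "lower q (\<lambda>y. complex_of_real (cw e y) * raise q u y) x
          = complex_of_real (cw e (x[q := x ! q + 1])) * (real (x ! q + 1) * u x)"
        using True q by (simp add: lower_def raise_def r del: of_nat_Suc)
      moreover have "lower q (raise q u) x = real (x ! q + 1) * u x"
        using True q by (simp add: lower_def raise_def r del: of_nat_Suc)
      ultimately show ?thesis
        using True b by (simp add: ladder_def \<theta>_def algebra_simps)
    next
      case b: False
      have "raise q (\<lambda>y. complex_of_real (cw e y) * lower q u y) x
          = complex_of_real (cw e (x[q := x ! q - 1])) * (real (x ! q) * u x)"
        using True q by (simp add: lower_def raise_def r)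
      moreover have "raise q (lower q u) x = real (x ! q) * u x"
        using True q by (simp add: lower_def raise_def r)
      ultimately show ?thesis
        using True b by (simp add: ladder_def \<theta>_def algebra_simps)
    qed
  next
    case False
    then show ?thesis
      using that by (cases b) (auto simp: ladder_def lower_def raise_def \<theta>_def supp_ok_def)
  qed
  show thesis
  proof (rule that[of \<theta>])
    show "\<theta> x \<le> cA * cw e x + cB" for x using ab[of x] by linarith
    show "\<exists>M. \<forall>x. \<bar>\<theta> x\<bar> \<le> M"
      using ab weight_bounded[OF e] by (meson abs_le_D1 order_trans)
  qed (use e1 in blast)
qed

text \<open>Moving one ladder operator across the pairing turns the difference into the form of the
  diagonal \<theta>, which lies below the multiplier defining \<open>Q\<close>.\<close>

lemma ladder_dissipation_le:
  assumes e: "e > 0" and q: "q < N" and u: "u \<in> Dfin N"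
  shows "Re (vinner (ladder b q u) (\<lambda>x. complex_of_real (cw e x) * ladder b q u x))
     - Re (vinner u (\<lambda>x. complex_of_real (cw e x) * ladder (\<not> b) q (ladder b q u) x)) \<le> Q e u"
proof -
  obtain \<theta> where \<theta>: "\<And>x. \<theta> x \<le> cA * cw e x + cB" "\<exists>M. \<forall>x. \<bar>\<theta> x\<bar> \<le> M" "\<And>u. supp_ok N u \<Longrightarrow>
     (\<lambda>x. ladder (\<not> b) q (\<lambda>y. complex_of_real (cw e y) * ladder b q u y) x)
     = (\<lambda>x. complex_of_real (cw e x) * ladder (\<not> b) q (ladder b q u) x + complex_of_real (\<theta> x) * u x)"
    using ladder_diag[OF e q] by blast
  then obtain M where M: "\<And>x. \<bar>\<theta> x\<bar> \<le> M" by blast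
  have f: "formal_adj N (ladder (\<not> b) q) (ladder b q)" "formal_adj N (ladder b q) (ladder (\<not> b) q)"
    using adj_pair_ladder[OF q] by (auto simp: adj_pair_def)
  note su = Dfin_supp_ok[OF u]
  have "vinner (ladder b q u) (\<lambda>x. complex_of_real (cw e x) * ladder b q u x)
      = vinner u (\<lambda>x. ladder (\<not> b) q (\<lambda>y. complex_of_real (cw e y) * ladder b q u y) x)"
    by (rule formal_adj_vinner[OF f(1) u, symmetric])
       (intro supp_ok_mult formal_adj_supp[OF f(2)] su)
  also have "\<dots> = vinner u (\<lambda>x. complex_of_real (cw e x) * ladder (\<not> b) q (ladder b q u) x)
      + vinner u (\<lambda>x. complex_of_real (\<theta> x) * u x)"
    unfolding \<theta>(3)[OF su] by (rule vinner_add_right_Dfin[OF u])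
  finally have "Re (vinner (ladder b q u) (\<lambda>x. complex_of_real (cw e x) * ladder b q u x))
     - Re (vinner u (\<lambda>x. complex_of_real (cw e x) * ladder (\<not> b) q (ladder b q u) x))
     = (\<Sum>\<^sub>\<infinity>x. \<theta> x * (cmod (u x))\<^sup>2)"
    by (simp add: vinner_real_diag_self)
  also have "\<dots> \<le> Q e u"
    unfolding Q_def
    by (intro infsum_mono summable_on_bounded_diag[OF Dfin_ell2[OF u] M]
        summable_on_Q[OF Dfin_ell2[OF u] e] mult_right_mono \<theta>(1)) auto
  finally show ?thesis .
qed

end

section \<open>Finite sums and scalar multiples\<close>

lemma vinner_sum_right_Dfin:
  assumes "finite A" "u \<in> Dfin N"
  shows "vinner u (\<lambda>x. \<Sum>a\<in>A. f a x) = (\<Sum>a\<in>A. vinner u (f a))"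
  using assms(1)
  by (induction A rule: finite_induct) (simp_all add: vinner_add_right_Dfin[OF assms(2)])

lemma has_sum_sum:
  fixes f :: "'a \<Rightarrow> 'b \<Rightarrow> 'c :: topological_comm_monoid_add"
  assumes "finite A" "\<And>a. a \<in> A \<Longrightarrow> (f a has_sum s a) B"
  shows "((\<lambda>x. \<Sum>a\<in>A. f a x) has_sum (\<Sum>a\<in>A. s a)) B"
  using assms by (induction A rule: finite_induct) (auto intro!: has_sum_add)

text \<open>Shaped for F: only the corner, the first row and the first column of the double sum
  survive.\<close>

lemma sum_bordered:
  fixes t :: "'a \<Rightarrow> 'a \<Rightarrow> 'b :: comm_monoid_add"
  assumes "finite J" "z \<notin> J" "\<And>i j. i \<in> J \<Longrightarrow> j \<in> J \<Longrightarrow> t i j = 0"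
  shows "(\<Sum>i\<in>insert z J. \<Sum>j\<in>insert z J. t i j) = t z z + (\<Sum>i\<in>J. t z i + t i z)"
  using assms by (simp add: sum.distrib add_ac)

lemma ell2_scaled_iff: "c \<noteq> 0 \<Longrightarrow> ell2 N (\<lambda>x. c * u x) \<longleftrightarrow> ell2 N u"
  using ell2_bounded_mult[of N u "\<lambda>_. c" "cmod c"]
    ell2_bounded_mult[of N "\<lambda>x. c * u x" "\<lambda>_. inverse c" "cmod (inverse c)"]
  by (auto simp: mult.assoc[symmetric])

section \<open>The channel operators and the coefficient matrix\<close>

locale boson_channels = boson +
  fixes g :: real and alpha :: "nat \<Rightarrow> nat \<Rightarrow> complex" and enum :: "nat \<Rightarrow> nat \<times> nat"
  assumes enum: "bij_betw enum {1..4*(n+m)} (channels n m)"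
begin

text \<open>The parity of the first channel index selects the group of modes, and its values 7 and 8
  mark the creation channels.\<close>

definition mode :: "nat \<Rightarrow> nat" where
  "mode r = (if odd (fst (enum r)) then snd (enum r) else n + snd (enum r))"
definition creates :: "nat \<Rightarrow> bool" where
  "creates r \<longleftrightarrow> fst (enum r) \<in> {7, 8}"
definition coef :: "nat \<Rightarrow> complex" where
  "coef r = alpha (fst (enum r)) (snd (enum r))"

definition R :: "nat \<Rightarrow> vec \<Rightarrow> vec" where
  "R r u = (\<lambda>x. coef r * ladder (creates r) (mode r) u x)"
definition Rs :: "nat \<Rightarrow> vec \<Rightarrow> vec" where
  "Rs r u = (\<lambda>x. cnj (coef r) * ladder (\<not> creates r) (mode r) u x)"

text \<open>K by a formula on all functions, with the formal adjoint \<open>Rs\<close> in place of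
  \<open>aapp\<close>. The factor of I is -i times i g/2, hence the real number g/2.\<close>

definition Kf :: "vec \<Rightarrow> vec" where
  "Kf u = (\<lambda>x. (- \<i> * complex_of_real (E x)) * u x
      + (complex_of_real (g / 2) * Iop n m u x + (- 1 / 2) * (\<Sum>r\<in>{1..4*N}. Rs r (R r u) x)))"

text \<open>A closure sees an operator only through its values on \<open>Dfin\<close>, where these
  formulas agree with \<open>Fop\<close>.\<close>

definition Ff :: "nat \<Rightarrow> nat \<Rightarrow> vec \<Rightarrow> vec" where
  "Ff i j = (if i = 0 \<and> j = 0 then Kf else if j = 0 then R i
      else if i = 0 then (\<lambda>u x. - Rs j u x) else (\<lambda>u x. 0))"

lemma enum_channel: "r \<in> {1..4*N} \<Longrightarrow> enum r \<in> channels n m"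
  using enum by (auto simp: bij_betw_def)

lemma mode_less: "r \<in> {1..4*N} \<Longrightarrow> mode r < N"
  using enum_channel[of r] by (auto simp: channels_def mode_def)

lemma chanop_R: "r \<in> {1..4*N} \<Longrightarrow> chanop n alpha (enum r) = R r"
  using enum_channel[of r]
  by (cases "enum r")
     (auto simp: fun_eq_iff channels_def chanop_def R_def coef_def ladder_def creates_def mode_def)

lemma adj_pair_R: "r \<in> {1..4*N} \<Longrightarrow> adj_pair N 1 (R r) (Rs r)"
  unfolding R_def Rs_def by (intro adj_pair_scale adj_pair_ladder mode_less)

lemma formal_adj_R:
  assumes "r \<in> {1..4*N}"
  shows "formal_adj N (R r) (Rs r)" "formal_adj N (Rs r) (R r)"
  using adj_pair_R[OF assms] by (auto simp: adj_pair_def)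

lemma aapp_R: "r \<in> {1..4*N} \<Longrightarrow> u \<in> Dfin N \<Longrightarrow> aapp N (R r) u = Rs r u"
  by (rule aapp_formal(2)[OF formal_adj_R])

lemma adj_pair_Kf: "\<exists>S. adj_pair N N Kf S"
proof -
  \<comment> \<open>Both groups of modes are nonempty, so the order 2 of the energy and of each Rs R
    stays within the order n+m of I.\<close>
  have N2: "2 \<le> N" using n m by simp
  have "adj_pair N 2 (\<lambda>u x. (- \<i> * complex_of_real (E x)) * u x)
      (\<lambda>u x. cnj (- \<i> * complex_of_real (E x)) * u x)"
  proof (rule adj_pair_diag)
    show "(cmod (- \<i> * complex_of_real (E x)))\<^sup>2 \<le> W\<^sup>2 * wgt x ^ 2" if "length x = N" for x
      using power_mono[OF energy_le_wgt[OF that] energy_nonneg, of 2] energy_nonneg[of x]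
      by (simp add: norm_mult power_mult_distrib)
  qed simp
  from adj_pair_mono[OF this N2]
  have a: "adj_pair N N (\<lambda>u x. (- \<i> * complex_of_real (E x)) * u x)
      (\<lambda>u x. cnj (- \<i> * complex_of_real (E x)) * u x)" .
  have b: "adj_pair N N (\<lambda>u x. complex_of_real (g / 2) * Iop n m u x)
      (\<lambda>u x. cnj (complex_of_real (g / 2)) * - Iop n m u x)"
    by (rule adj_pair_scale[OF adj_pair_Iop])
  have "adj_pair N N (\<lambda>u. Rs r (R r u)) (\<lambda>u. Rs r (R r u))" if "r \<in> {1..4*N}" for r
    using adj_pair_comp[OF adj_pair_sym[OF adj_pair_R[OF that]] adj_pair_R[OF that]]
    by (rule adj_pair_mono) (use N2 in simp)
  then have c: "adj_pair N N (\<lambda>u x. (- 1 / 2) * (\<Sum>r\<in>{1..4*N}. Rs r (R r u) x))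
      (\<lambda>u x. cnj (- 1 / 2) * (\<Sum>r\<in>{1..4*N}. Rs r (R r u) x))"
    by (intro adj_pair_scale adj_pair_sum) auto
  show ?thesis
    using adj_pair_add[OF a adj_pair_add[OF b c]] unfolding Kf_def by blast
qed

lemma adj_pair_Ff:
  assumes "i \<in> {0..4*N}" "j \<in> {0..4*N}"
  shows "\<exists>S. adj_pair N N (Ff i j) S"
proof -
  have "\<exists>S. adj_pair N N (R r) S" "\<exists>S. adj_pair N N (\<lambda>u x. - Rs r u x) S" if "r \<in> {1..4*N}" for r
  proof -
    have a: "adj_pair N N (R r) (Rs r)"
      by (rule adj_pair_mono[OF adj_pair_R[OF that]]) (use n in simp)
    then show "\<exists>S. adj_pair N N (R r) S" by blast
    show "\<exists>S. adj_pair N N (\<lambda>u x. - Rs r u x) S"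
      using adj_pair_uminus[OF adj_pair_sym[OF a]] by blast
  qed
  then show ?thesis
    using assms adj_pair_Kf adj_pair_zero[of N N] by (auto simp: Ff_def)
qed

lemma Kop_Kf: "u \<in> Dfin N \<Longrightarrow> Kop n m ws wp g alpha enum u = Kf u"
proof
  fix x assume u: "u \<in> Dfin N"
  have "Rsum n m alpha enum u x = (\<Sum>r\<in>{1..4*N}. Rs r (R r u) x)"
    unfolding Rsum_def
    by (intro sum.cong refl) (simp add: chanop_R aapp_R formal_adj_Dfin[OF formal_adj_R(1)] u)
  then show "Kop n m ws wp g alpha enum u x = Kf u x"
    by (simp add: Kop_def Kf_def Hop_def Nop_def algebra_simps)
qed

lemma Fop_Ff:
  assumes "i \<in> {0..4*N}" "j \<in> {0..4*N}" "u \<in> Dfin N"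
  shows "Fop n m ws wp g alpha enum i j u = Ff i j u"
  using assms by (auto simp: Fop_def Ff_def Kop_Kf chanop_R aapp_R)

lemma clos_graph_Fop:
  assumes "i \<in> {0..4*N}" "j \<in> {0..4*N}"
  shows "clos_graph N (Fop n m ws wp g alpha enum i j) = clos_graph N (Ff i j)"
  by (rule clos_graph_cong) (rule Fop_Ff[OF assms])

lemma capp_Fop:
  assumes "i \<in> {0..4*N}" "j \<in> {0..4*N}" "u \<in> cdom N (Fop n m ws wp g alpha enum i j)"
  shows "(u, Ff i j u) \<in> clos_graph N (Ff i j)" "capp N (Fop n m ws wp g alpha enum i j) u = Ff i j u"
proof -
  obtain S where S: "adj_pair N N (Ff i j) S" using adj_pair_Ff[OF assms(1,2)] by blast
  then have f: "formal_adj N (Ff i j) S" "formal_adj N S (Ff i j)" by (auto simp: adj_pair_def)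
  have u: "u \<in> cdom N (Ff i j)"
    using assms(3) by (simp add: cdom_def clos_graph_Fop[OF assms(1,2)])
  show "(u, Ff i j u) \<in> clos_graph N (Ff i j)" by (rule capp_formal(1)[OF f u])
  show "capp N (Fop n m ws wp g alpha enum i j) u = Ff i j u"
    using capp_formal(2)[OF f u] by (simp add: capp_def clos_graph_Fop[OF assms(1,2)])
qed

lemma Chalf_dom_subset_cdom:
  assumes "i \<in> {0..4*N}" "j \<in> {0..4*N}"
  shows "Chalf_dom n m ws wp \<subseteq> cdom N (Fop n m ws wp g alpha enum i j)"
proof
  fix u assume "u \<in> Chalf_dom n m ws wp"
  then have "u \<in> cdom N (Ff i j)"
    using adj_pair_Ff[OF assms] weighted_subset_cdom Chalf_dom_wsummable by blast
  then show "u \<in> cdom N (Fop n m ws wp g alpha enum i j)"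
    by (simp add: cdom_def clos_graph_Fop[OF assms])
qed

lemma Ceps_half_Dfin: "u \<in> Dfin N \<Longrightarrow> Ceps_half n m ws wp e u \<in> Dfin N"
  unfolding Ceps_half_def by (rule Dfin_mult)

lemma adjoint_Ceps_half_bounded:
  assumes "i \<in> {0..4*N}" "j \<in> {0..4*N}" and e: "e > 0"
  shows "\<forall>u\<in>Dfin N. Ceps_half n m ws wp e u \<in> adom N (Fop n m ws wp g alpha enum i j)"
    and "\<exists>M. \<forall>u\<in>Dfin N. vnorm (aapp N (Fop n m ws wp g alpha enum i j) (Ceps_half n m ws wp e u))
      \<le> M * vnorm u"
proof -
  obtain S where S: "adj_pair N N (Ff i j) S" using adj_pair_Ff[OF assms(1,2)] by blast
  then have f: "formal_adj N (Ff i j) S" "formal_adj N S (Ff i j)" and o: "order_le N N S"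
    by (auto simp: adj_pair_def)
  show "\<forall>u\<in>Dfin N. Ceps_half n m ws wp e u \<in> adom N (Fop n m ws wp g alpha enum i j)"
    using aapp_formal(1)[OF f Ceps_half_Dfin] by (simp add: adom_def clos_graph_Fop[OF assms(1,2)])
  have "aapp N (Fop n m ws wp g alpha enum i j) (Ceps_half n m ws wp e u)
      = S (Ceps_half n m ws wp e u)" if "u \<in> Dfin N" for u
    using aapp_formal(2)[OF f Ceps_half_Dfin[OF that]]
    by (simp add: aapp_def clos_graph_Fop[OF assms(1,2)])
  then show "\<exists>M. \<forall>u\<in>Dfin N. vnorm (aapp N (Fop n m ws wp g alpha enum i j) (Ceps_half n m ws wp e u))
      \<le> M * vnorm u"
    using order_le_bounded[OF o wgt_Ceps_half_bounded[OF e]] by (simp add: Ceps_half_def)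
qed

subsection \<open>The form inequality\<close>

lemma R_commutator_bound:
  assumes e: "e > 0" and r: "r \<in> {1..4*N}" and u: "ell2 N u" and v: "ell2 N v"
    and ru: "ell2 N (Rs r u)" and rv: "ell2 N (R r v)"
  shows "cmod (vinner u (Ceps n m ws wp e (R r v)) - vinner (Rs r u) (Ceps n m ws wp e v))
      \<le> cmod (coef r) * ((Q e u + Q e v) / 2)"
\<comment> \<open>A zero coefficient is treated apart: \<open>R r v\<close> in l2 then says nothing
  about the ladder operator itself.\<close>
proof (cases "coef r = 0")
  case True
  then show ?thesis by (simp add: R_def Rs_def Ceps_cw)
next
  case False
  let ?C = "\<lambda>(w :: vec) x. complex_of_real (cw e x) * w x"
  let ?l = "ladder (creates r) (mode r)" and ?l' = "ladder (\<not> creates r) (mode r)"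
  have l: "ell2 N (?l v)" "ell2 N (?l' u)"
    using ru rv ell2_scaled_iff[of "coef r" N] ell2_scaled_iff[of "cnj (coef r)" N] False
    by (simp_all add: R_def Rs_def)
  have "vinner u (?C (R r v)) = coef r * vinner u (?C (?l v))"
    unfolding R_def by (simp add: mult.left_commute vinner_mult_right)
  moreover have "vinner (Rs r u) (?C v) = coef r * vinner (?l' u) (?C v)"
    unfolding Rs_def by (simp add: vinner_mult_left)
  ultimately have "vinner u (?C (R r v)) - vinner (Rs r u) (?C v)
      = coef r * (vinner u (?C (?l v)) - vinner (?l' u) (?C v))"
    by (simp add: right_diff_distrib)
  then show ?thesis
    unfolding Ceps_cw
    using mult_left_mono[OF ladder_commutator_bound[OF e mode_less[OF r] u v l(2,1)], of "cmod (coef r)"]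
    by (simp add: norm_mult)
qed

lemma R_dissipation_le:
  assumes e: "e > 0" and r: "r \<in> {1..4*N}" and u: "u \<in> Dfin N"
  shows "Re (vinner (R r u) (Ceps n m ws wp e (R r u))) - Re (vinner u (Ceps n m ws wp e (Rs r (R r u))))
      \<le> (cmod (coef r))\<^sup>2 * Q e u"
proof -
  let ?C = "\<lambda>(w :: vec) x. complex_of_real (cw e x) * w x"
  let ?l = "ladder (creates r) (mode r)" and ?l' = "ladder (\<not> creates r) (mode r)"
  have k: "cnj (coef r) * coef r = complex_of_real ((cmod (coef r))\<^sup>2)"
    by (simp only: complex_norm_square mult.commute)
  have "vinner (R r u) (?C (R r u)) = cnj (coef r) * (coef r * vinner (?l u) (?C (?l u)))"
    unfolding R_def by (simp add: mult.left_commute vinner_mult_right vinner_mult_left)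
  then have 1: "vinner (R r u) (?C (R r u)) = complex_of_real ((cmod (coef r))\<^sup>2) * vinner (?l u) (?C (?l u))"
    using k by (simp only: mult.assoc[symmetric])
  have lin: "?l' (\<lambda>x. coef r * ?l u x) = (\<lambda>x. coef r * ?l' (?l u) x)"
    by (auto simp: ladder_def lower_def raise_def fun_eq_iff)
  have "vinner u (?C (Rs r (R r u))) = cnj (coef r) * (coef r * vinner u (?C (?l' (?l u))))"
    unfolding Rs_def R_def lin by (simp add: mult.left_commute[of "complex_of_real _"] vinner_mult_right)
  then have 2: "vinner u (?C (Rs r (R r u))) = complex_of_real ((cmod (coef r))\<^sup>2) * vinner u (?C (?l' (?l u)))"
    using k by (simp only: mult.assoc[symmetric])
  show ?thesis
    unfolding Ceps_cw 1 2
    using mult_left_mono[OF ladder_dissipation_le[OF e mode_less[OF r] u], of "(cmod (coef r))\<^sup>2"]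
    by (simp add: right_diff_distrib)
qed

text \<open>C_epsilon is symmetric and commutes with the skew operator I, so the form equals minus
  its conjugate. As I has a real factor in K, it disappears from the real part.\<close>

lemma Iop_form_imaginary:
  assumes u: "u \<in> Dfin N"
  shows "Re (vinner u (\<lambda>x. complex_of_real (cw e x) * Iop n m u x)) = 0"
proof -
  let ?C = "\<lambda>(w :: vec) x. complex_of_real (cw e x) * w x"
  note su = Dfin_supp_ok[OF u]
  have f: "formal_adj N (Iop n m) (\<lambda>u x. - Iop n m u x)"
    using adj_pair_Iop by (simp add: adj_pair_def)
  have "?C (Iop n m u) = Iop n m (?C u)"
    using Iop_energy[OF su, of "\<lambda>y. complex_of_real (creg (2 * N) e y)"] by (simp add: cw_def)
  then have "vinner u (?C (Iop n m u)) = vinner u (Iop n m (?C u))" by simp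
  also have "\<dots> = vinner (\<lambda>x. - Iop n m u x) (?C u)"
    by (rule formal_adj_vinner[OF f u supp_ok_mult[OF su]])
  also have "\<dots> = - vinner (Iop n m u) (?C u)"
    using vinner_mult_left[of "-1" "Iop n m u" "?C u"] by simp
  also have "vinner (Iop n m u) (?C u) = cnj (vinner u (?C (Iop n m u)))"
    by (metis cnj_vinner vinner_real_mult_left)
  finally have "vinner u (?C (Iop n m u)) = - cnj (vinner u (?C (Iop n m u)))" .
  moreover have "Re z = 0" if "z = - cnj z" for z
    using arg_cong[OF that, of Re] by simp
  ultimately show ?thesis by blast
qed

definition a2 :: real where "a2 = (\<Sum>r\<in>{1..4*N}. (cmod (coef r))\<^sup>2)"

text \<open>In the real part the energy contributes -i times a real number and I contributes
  nothing. What remains for each channel is the real part of the form of R* C R - C R* R, which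
  \<open>R_dissipation_le\<close> bounds.\<close>

lemma Kf_form_le_Dfin:
  assumes e: "e > 0" and u: "u \<in> Dfin N"
  shows "2 * Re (vinner u (Ceps n m ws wp e (Kf u)))
      + (\<Sum>r\<in>{1..4*N}. Re (vinner (R r u) (Ceps n m ws wp e (R r u)))) \<le> a2 * Q e u"
proof -
  let ?C = "\<lambda>(w :: vec) x. complex_of_real (cw e x) * w x"
  have "?C (Kf u) = (\<lambda>x. (- \<i>) * (complex_of_real (cw e x * E x) * u x)
      + (complex_of_real (g / 2) * ?C (Iop n m u) x
        + (- 1 / 2) * (\<Sum>r\<in>{1..4*N}. ?C (Rs r (R r u)) x)))"
    by (auto simp: Kf_def algebra_simps sum_distrib_left)
  then have "vinner u (?C (Kf u)) = (- \<i>) * vinner u (\<lambda>x. complex_of_real (cw e x * E x) * u x)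
      + (complex_of_real (g / 2) * vinner u (?C (Iop n m u))
        + (- 1 / 2) * (\<Sum>r\<in>{1..4*N}. vinner u (?C (Rs r (R r u)))))"
    by (simp only: vinner_add_right_Dfin[OF u] vinner_mult_right
        vinner_sum_right_Dfin[OF finite_atLeastAtMost u])
  moreover have "Im (vinner u (\<lambda>x. complex_of_real (cw e x * E x) * u x)) = 0"
    unfolding vinner_real_diag_self by simp
  ultimately have "2 * Re (vinner u (?C (Kf u))) = - (\<Sum>r\<in>{1..4*N}. Re (vinner u (?C (Rs r (R r u)))))"
    using Iop_form_imaginary[OF u, of e] by (simp add: Re_divide_numeral)
  then have "2 * Re (vinner u (Ceps n m ws wp e (Kf u)))
      + (\<Sum>r\<in>{1..4*N}. Re (vinner (R r u) (Ceps n m ws wp e (R r u))))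
    = (\<Sum>r\<in>{1..4*N}. Re (vinner (R r u) (Ceps n m ws wp e (R r u)))
        - Re (vinner u (Ceps n m ws wp e (Rs r (R r u)))))"
    by (simp add: Ceps_cw sum_subtractf)
  also have "\<dots> \<le> (\<Sum>r\<in>{1..4*N}. (cmod (coef r))\<^sup>2 * Q e u)"
    by (intro sum_mono R_dissipation_le e u)
  finally show ?thesis by (simp add: a2_def sum_distrib_right)
qed

lemma R_form: "Re (vinner (R r u) (Ceps n m ws wp e (R r u))) = (\<Sum>\<^sub>\<infinity>x. cw e x * (cmod (R r u x))\<^sup>2)"
  unfolding Ceps_cw vinner_real_diag_self by simp

text \<open>Only the closure of \<open>K\<close> is approximated along a sequence in \<open>Dfin\<close>: convergence of
  the channel terms is not needed, since they are nonnegative and Fatou applies.\<close>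

lemma Kf_form_le:
  assumes e: "e > 0" and u: "(u, Kf u) \<in> clos_graph N Kf" and Ru: "\<And>r. r \<in> {1..4*N} \<Longrightarrow> ell2 N (R r u)"
  shows "2 * Re (vinner u (Ceps n m ws wp e (Kf u)))
      + (\<Sum>r\<in>{1..4*N}. Re (vinner (R r u) (Ceps n m ws wp e (R r u)))) \<le> a2 * Q e u"
proof -
  obtain U where eu: "ell2 N u" and ek: "ell2 N (Kf u)" and U: "\<And>k. U k \<in> Dfin N"
    and l: "(\<lambda>k. vnorm (U k - u)) \<longlonglongrightarrow> 0" "(\<lambda>k. vnorm (Kf (U k) - Kf u)) \<longlonglongrightarrow> 0"
    using u unfolding clos_graph_def by blast
  obtain S where "adj_pair N N Kf S" using adj_pair_Kf by blast
  then have KD: "Kf (U k) \<in> Dfin N" for k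
    using formal_adj_Dfin[OF _ U] by (auto simp: adj_pair_def)
  have lK: "(\<lambda>k. vinner (U k) (Ceps n m ws wp e (Kf (U k)))) \<longlonglongrightarrow> vinner u (Ceps n m ws wp e (Kf u))"
    unfolding Ceps_cw
    by (rule vinner_diag_tendsto[OF _ _ eu ek l norm_cw_bounded[OF e]]) (intro Dfin_ell2 U KD)+
  have QRe: "Q e w = Re (vinner w (\<lambda>x. complex_of_real (cA * cw e x + cB) * w x))" for w
    unfolding Q_def vinner_real_diag_self by simp
  have lQ: "(\<lambda>k. Q e (U k)) \<longlonglongrightarrow> Q e u"
    unfolding QRe
    by (intro tendsto_Re vinner_diag_tendsto[OF _ _ eu eu l(1) l(1), where M = "cA * (1 / e) + cB"]
        Dfin_ell2 U) (use weight_bounded[OF e] in \<open>simp only: norm_of_real\<close>)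
  define G where "G = a2 * Q e u - 2 * Re (vinner u (Ceps n m ws wp e (Kf u)))"
  have lG: "(\<lambda>k. a2 * Q e (U k) - 2 * Re (vinner (U k) (Ceps n m ws wp e (Kf (U k))))) \<longlonglongrightarrow> G"
    unfolding G_def by (intro tendsto_intros lK lQ)
  let ?h = "\<lambda>w x. \<Sum>r\<in>{1..4*N}. cw e x * (cmod (R r w x))\<^sup>2"
  have sR: "(\<lambda>x. cw e x * (cmod (R r u x))\<^sup>2) summable_on UNIV" if "r \<in> {1..4*N}" for r
    by (rule summable_on_cw[OF Ru[OF that] e])
  \<comment> \<open>On a finite set of lists the channel sums converge coordinatewise, so the bound
    survives the limit; letting the set grow completes the Fatou argument.\<close>
  have fin: "sum (?h u) X \<le> G" if X: "finite X" for X
  proof (rule LIMSEQ_le[OF _ lG])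
    have "(\<lambda>k. R r (U k) x) \<longlonglongrightarrow> R r u x" if r: "r \<in> {1..4*N}" for r x
      by (rule formal_adj_tendsto[OF formal_adj_R[OF r]])
         (intro Dfin_supp_ok U ell2_supp_ok eu vnorm_diff_tendsto_pointwise[OF Dfin_ell2[OF U] eu l(1)])+
    then show "(\<lambda>k. sum (?h (U k)) X) \<longlonglongrightarrow> sum (?h u) X"
      by (intro tendsto_intros)
    have "sum (?h (U k)) X \<le> a2 * Q e (U k) - 2 * Re (vinner (U k) (Ceps n m ws wp e (Kf (U k))))" for k
    proof -
      have "sum (?h (U k)) X = (\<Sum>r\<in>{1..4*N}. \<Sum>x\<in>X. cw e x * (cmod (R r (U k) x))\<^sup>2)"
        by (rule sum.swap)
      also have "\<dots> \<le> (\<Sum>r\<in>{1..4*N}. \<Sum>\<^sub>\<infinity>x. cw e x * (cmod (R r (U k) x))\<^sup>2)"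
        using cw_nonneg
        by (intro sum_mono finite_sum_le_infsum X summable_on_cw[OF _ e] Dfin_ell2
            formal_adj_Dfin[OF formal_adj_R(1)] U) auto
      finally show ?thesis
        using Kf_form_le_Dfin[OF e U, of k] by (simp only: R_form)
    qed
    then show "\<exists>M. \<forall>k\<ge>M. sum (?h (U k)) X
        \<le> a2 * Q e (U k) - 2 * Re (vinner (U k) (Ceps n m ws wp e (Kf (U k))))" by blast
  qed
  have hs: "(?h u has_sum (\<Sum>r\<in>{1..4*N}. \<Sum>\<^sub>\<infinity>x. cw e x * (cmod (R r u x))\<^sup>2)) UNIV"
    by (intro has_sum_sum has_sum_infsum sR) auto
  have "(\<Sum>r\<in>{1..4*N}. \<Sum>\<^sub>\<infinity>x. cw e x * (cmod (R r u x))\<^sup>2) \<le> G"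
    by (rule has_sum_le_finite_sums[OF hs fin])
  then show ?thesis
    unfolding R_form G_def by simp
qed

text \<open>u_0 receives \<open>a2\<close> from the corner and one |coef r| from each channel, while
  u_r receives only its own |coef r|; this sum dominates all of these.\<close>

definition aF :: real where "aF = a2 + (\<Sum>r\<in>{1..4*N}. cmod (coef r))"

lemma aF_nonneg: "aF \<ge> 0"
  unfolding aF_def a2_def by (intro add_nonneg_nonneg sum_nonneg) auto

lemma coef_le_aF: "r \<in> {1..4*N} \<Longrightarrow> cmod (coef r) \<le> aF"
  unfolding aF_def a2_def
  by (intro add_increasing sum_nonneg member_le_sum) auto

lemma form_inequality:
  assumes e: "e > 0"
    and us: "\<And>i k l. i \<in> {0..4*N} \<Longrightarrow> k \<in> {0..4*N} \<Longrightarrow> l \<in> {0..4*N} \<Longrightarrow>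
      (us i, Ff k l (us i)) \<in> clos_graph N (Ff k l)"
  shows "(\<Sum>i\<in>{0..4*N}. \<Sum>j\<in>{0..4*N}.
          vinner (us i) (Ceps n m ws wp e (Ff i j (us j)))
        + vinner (Ff j i (us i)) (Ceps n m ws wp e (us j))
        + (\<Sum>k\<in>{1..4*N}. vinner (Ff k i (us i)) (Ceps n m ws wp e (Ff k j (us j)))))
     \<le> (\<Sum>i\<in>{0..4*N}. complex_of_real (aF * cA) * vinner (us i) (Ceps n m ws wp e (us i))
          + complex_of_real (aF * cB * (vnorm (us i))\<^sup>2))"
    (is "(\<Sum>i\<in>?I. \<Sum>j\<in>?I. ?T i j) \<le> ?rhs")
proof -
  let ?C = "Ceps n m ws wp e" and ?J = "{1..4*N}"
  have eu: "ell2 N (us i)" "ell2 N (Ff k l (us i))" if "i \<in> ?I" "k \<in> ?I" "l \<in> ?I" for i k l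
    using us[OF that] by (auto simp: clos_graph_def)
  have C0: "?C (\<lambda>x. 0) = (\<lambda>x. 0)" by (simp add: Ceps_def)
  have sw: "vinner a (?C b) = cnj (vinner b (?C a))" for a b
    unfolding Ceps_cw by (metis cnj_vinner vinner_real_mult_left)
  \<comment> \<open>The entry (j,0): R_j from the first column meets -R_j* from the first row,
    giving the form of the commutator of C_epsilon with R_j between u_j and u_0.\<close>
  define X where "X j = vinner (us j) (?C (R j (us 0))) - vinner (Rs j (us j)) (?C (us 0))" for j
  have vm: "vinner (\<lambda>x. - a x) b = - vinner a b" for a b
    using vinner_mult_left[of "-1" a b] by simp
  have T0: "?T i 0 = X i" "?T 0 i = cnj (X i)" if "i \<in> ?J" for i
  proof -
    have F: "Ff i 0 = R i" "Ff 0 i = (\<lambda>u x. - Rs i u x)" using that by (auto simp: Ff_def)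
    have z: "Ff k i (us i) = (\<lambda>x. 0)" if "k \<in> ?J" for k using that \<open>i \<in> ?J\<close> by (auto simp: Ff_def)
    have "(\<Sum>k\<in>?J. vinner (Ff k i (us i)) (?C (Ff k 0 (us 0)))) = 0"
      by (intro sum.neutral ballI) (simp only: z vinner_zero_left)
    then show 1: "?T i 0 = X i"
      by (simp add: F vm X_def)
    \<comment> \<open>Symmetry of C_epsilon makes the array Hermitian, so the first row is the
      conjugate of the first column.\<close>
    have "?T 0 i = cnj (?T i 0)"
      unfolding complex_cnj_add cnj_sum
      by (simp only: sw[symmetric] add.commute add.left_commute add.assoc)
    then show "?T 0 i = cnj (X i)" unfolding 1 .
  qed
  have T1: "?T i j = 0" if "i \<in> ?J" "j \<in> ?J" for i j
  proof -
    have z: "Ff k l = (\<lambda>u x. 0)" if "k \<in> ?J" "l \<in> ?J" for k l using that by (auto simp: Ff_def)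
    have "(\<Sum>k\<in>?J. vinner (Ff k i (us i)) (?C (Ff k j (us j)))) = 0"
      by (intro sum.neutral ballI) (simp only: z that vinner_zero_left)
    then show ?thesis
      by (simp only: z that C0 vinner_zero_left vinner_zero_right) simp
  qed
  have I: "?I = insert 0 ?J" by auto
  have J0: "0 \<notin> ?J" by simp
  have "(\<Sum>i\<in>?I. \<Sum>j\<in>?I. ?T i j) = ?T 0 0 + (\<Sum>i\<in>?J. ?T 0 i + ?T i 0)"
    unfolding I by (rule sum_bordered[OF finite_atLeastAtMost J0 T1])
  also have "(\<Sum>i\<in>?J. ?T 0 i + ?T i 0) = (\<Sum>i\<in>?J. cnj (X i) + X i)"
    by (intro sum.cong refl arg_cong2[where f = "(+)"] T0)
  also have "?T 0 0 = complex_of_real (2 * Re (vinner (us 0) (?C (Kf (us 0))))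
      + (\<Sum>r\<in>?J. Re (vinner (R r (us 0)) (?C (R r (us 0))))))"
  proof -
    have "vinner (us 0) (?C (Kf (us 0))) + vinner (Kf (us 0)) (?C (us 0))
        = complex_of_real (2 * Re (vinner (us 0) (?C (Kf (us 0)))))"
      unfolding sw[of "Kf (us 0)"] by (rule complex_add_cnj)
    moreover have "vinner (R r (us 0)) (?C (R r (us 0)))
        = complex_of_real (Re (vinner (R r (us 0)) (?C (R r (us 0)))))" for r
      unfolding Ceps_cw vinner_real_diag_self by simp
    then have "(\<Sum>r\<in>?J. vinner (R r (us 0)) (?C (R r (us 0))))
        = complex_of_real (\<Sum>r\<in>?J. Re (vinner (R r (us 0)) (?C (R r (us 0)))))"
      by (simp only: of_real_sum)
    moreover have "?T 0 0 = vinner (us 0) (?C (Kf (us 0))) + vinner (Kf (us 0)) (?C (us 0))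
        + (\<Sum>r\<in>?J. vinner (R r (us 0)) (?C (R r (us 0))))"
      by (intro arg_cong2[where f = "(+)"] sum.cong) (auto simp: Ff_def)
    ultimately show ?thesis by (simp only: of_real_add)
  qed
  also have "(\<Sum>i\<in>?J. cnj (X i) + X i) = complex_of_real (\<Sum>i\<in>?J. 2 * Re (X i))"
    unfolding of_real_sum by (intro sum.cong refl) (metis add.commute complex_add_cnj)
  \<comment> \<open>The order on complex numbers demands equal imaginary parts, so both sides are
    first exhibited as images of real numbers.\<close>
  finally have lhs: "(\<Sum>i\<in>?I. \<Sum>j\<in>?I. ?T i j) = complex_of_real
      (2 * Re (vinner (us 0) (?C (Kf (us 0)))) + (\<Sum>r\<in>?J. Re (vinner (R r (us 0)) (?C (R r (us 0)))))
      + (\<Sum>i\<in>?J. 2 * Re (X i)))"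
    by (simp only: of_real_add)
  have rhs: "?rhs = complex_of_real (\<Sum>i\<in>?I. aF * Q e (us i))"
    unfolding of_real_sum
  proof (intro sum.cong refl)
    fix i assume "i \<in> ?I"
    then have "ell2 N (us i)" using eu(1)[of i 0 0] by simp
    then show "complex_of_real (aF * cA) * vinner (us i) (?C (us i)) + complex_of_real (aF * cB * (vnorm (us i))\<^sup>2)
        = complex_of_real (aF * Q e (us i))"
      unfolding Ceps_cw vinner_real_diag_self Q_split[OF _ e]
      by (simp add: Q_split e algebra_simps)
  qed
  have RJ: "ell2 N (R r (us 0))" "ell2 N (Rs r (us r))" "ell2 N (us r)" "ell2 N (us 0)" if "r \<in> ?J" for r
  proof -
    show "ell2 N (R r (us 0))" using eu(2)[of 0 r 0] that by (simp add: Ff_def split: if_splits)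
    have "ell2 N (\<lambda>x. (-1) * Rs r (us r) x)"
      using eu(2)[of r 0 r] that by (simp add: Ff_def split: if_splits)
    then show "ell2 N (Rs r (us r))" using ell2_scaled_iff[of "-1" N "Rs r (us r)"] by simp
    show "ell2 N (us r)" "ell2 N (us 0)" using eu(1)[of _ 0 0] that by auto
  qed
  have K: "(us 0, Kf (us 0)) \<in> clos_graph N Kf"
    using us[of 0 0 0] by (simp add: Ff_def)
  \<comment> \<open>Two conjugate border entries cancel the factor 1/2. The share of u_0 keeps its
    exact coefficient because it is summed over all channels; that of u_r is enlarged to
    \<open>aF\<close>.\<close>
  have X: "2 * Re (X r) \<le> cmod (coef r) * Q e (us 0) + aF * Q e (us r)" if r: "r \<in> ?J" for r
  proof -
    have "Re (X r) \<le> cmod (coef r) * ((Q e (us r) + Q e (us 0)) / 2)"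
      unfolding X_def
      by (rule order_trans[OF complex_Re_le_cmod R_commutator_bound[OF e r RJ(3,4,2,1)[OF r]]])
    moreover have "cmod (coef r) * Q e (us r) \<le> aF * Q e (us r)"
      by (intro mult_right_mono coef_le_aF r Q_nonneg)
    ultimately show ?thesis by (simp add: algebra_simps)
  qed
  have "2 * Re (vinner (us 0) (?C (Kf (us 0)))) + (\<Sum>r\<in>?J. Re (vinner (R r (us 0)) (?C (R r (us 0)))))
      + (\<Sum>i\<in>?J. 2 * Re (X i))
    \<le> a2 * Q e (us 0) + (\<Sum>r\<in>?J. cmod (coef r) * Q e (us 0) + aF * Q e (us r))"
    by (intro add_mono Kf_form_le e K RJ(1) sum_mono X)
  also have "\<dots> = aF * Q e (us 0) + (\<Sum>r\<in>?J. aF * Q e (us r))"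
    by (simp add: aF_def sum.distrib sum_distrib_right distrib_right)
  also have "\<dots> = (\<Sum>i\<in>?I. aF * Q e (us i))"
    unfolding I by (simp only: sum.insert[OF finite_atLeastAtMost J0])
  finally show ?thesis
    unfolding lhs rhs by (simp add: less_eq_complex_def)
qed

end

theorem mainTheorem8:
  fixes n m :: nat and ws wp :: "nat \<Rightarrow> real" and g :: real
    and alpha :: "nat \<Rightarrow> nat \<Rightarrow> complex" and enum :: "nat \<Rightarrow> nat \<times> nat"
  assumes "n \<ge> 1" and "m \<ge> 1"
    and "\<And>k. k < n \<Longrightarrow> ws k > 0" and "\<And>j. j < m \<Longrightarrow> wp j > 0"
    and "g \<noteq> 0"
    and "bij_betw enum {1..4*(n+m)} (channels n m)"
    and "(\<Sum>k<n. ws k) = (\<Sum>j<m. wp j)"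
  shows "\<exists>\<delta>>0. \<exists>b1 b2. b1 \<ge> 0 \<and> b2 \<ge> 0 \<and>
    Chalf_dom n m ws wp \<subseteq> (\<Inter>i\<in>{0..4*(n+m)}. \<Inter>j\<in>{0..4*(n+m)}.
        cdom (n+m) (Fop n m ws wp g alpha enum i j)) \<and>
    (\<forall>\<epsilon>. 0 < \<epsilon> \<and> \<epsilon> < \<delta> \<longrightarrow>
       (\<forall>u\<in>Dfin (n+m). Ceps_half n m ws wp \<epsilon> u \<in> Dfin (n+m)) \<and>
       (\<forall>i\<in>{0..4*(n+m)}. \<forall>j\<in>{0..4*(n+m)}.
          (\<forall>u\<in>Dfin (n+m). Ceps_half n m ws wp \<epsilon> u \<in> adom (n+m) (Fop n m ws wp g alpha enum i j)) \<and>
          (\<exists>M. \<forall>u\<in>Dfin (n+m).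
             vnorm (aapp (n+m) (Fop n m ws wp g alpha enum i j) (Ceps_half n m ws wp \<epsilon> u))
               \<le> M * vnorm u))) \<and>
    (\<forall>\<epsilon> us. 0 < \<epsilon> \<and> \<epsilon> < \<delta> \<and>
       (\<forall>i\<in>{0..4*(n+m)}. us i \<in> (\<Inter>i'\<in>{0..4*(n+m)}. \<Inter>j'\<in>{0..4*(n+m)}.
           cdom (n+m) (Fop n m ws wp g alpha enum i' j'))) \<longrightarrow>
       (\<Sum>i\<in>{0..4*(n+m)}. \<Sum>j\<in>{0..4*(n+m)}.
          vinner (us i) (Ceps n m ws wp \<epsilon> (capp (n+m) (Fop n m ws wp g alpha enum i j) (us j)))
        + vinner (capp (n+m) (Fop n m ws wp g alpha enum j i) (us i)) (Ceps n m ws wp \<epsilon> (us j))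
        + (\<Sum>k\<in>{1..4*(n+m)}.
            vinner (capp (n+m) (Fop n m ws wp g alpha enum k i) (us i))
                   (Ceps n m ws wp \<epsilon> (capp (n+m) (Fop n m ws wp g alpha enum k j) (us j)))))
       \<le> (\<Sum>i\<in>{0..4*(n+m)}.
            complex_of_real b1 * vinner (us i) (Ceps n m ws wp \<epsilon> (us i))
          + complex_of_real (b2 * (vnorm (us i))^2)))"
proof -
  interpret boson_channels n m ws wp g alpha enum
    using assms by unfold_locales auto
  let ?F = "Fop n m ws wp g alpha enum" and ?I = "{0..4*(n+m)}"
  have dom: "Chalf_dom n m ws wp \<subseteq> (\<Inter>i\<in>?I. \<Inter>j\<in>?I. cdom (n+m) (?F i j))"
    by (intro INT_greatest Chalf_dom_subset_cdom)
  have bdd: "(\<forall>u\<in>Dfin (n+m). Ceps_half n m ws wp \<epsilon> u \<in> Dfin (n+m)) \<and>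
      (\<forall>i\<in>?I. \<forall>j\<in>?I.
        (\<forall>u\<in>Dfin (n+m). Ceps_half n m ws wp \<epsilon> u \<in> adom (n+m) (?F i j)) \<and>
        (\<exists>M. \<forall>u\<in>Dfin (n+m). vnorm (aapp (n+m) (?F i j) (Ceps_half n m ws wp \<epsilon> u)) \<le> M * vnorm u))"
    if "0 < \<epsilon> \<and> \<epsilon> < 1" for \<epsilon>
    using that by (intro conjI ballI Ceps_half_Dfin adjoint_Ceps_half_bounded(1)[rule_format]
        adjoint_Ceps_half_bounded(2)) auto
  have form: "(\<Sum>i\<in>?I. \<Sum>j\<in>?I.
          vinner (us i) (Ceps n m ws wp \<epsilon> (capp (n+m) (?F i j) (us j)))
        + vinner (capp (n+m) (?F j i) (us i)) (Ceps n m ws wp \<epsilon> (us j))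
        + (\<Sum>k\<in>{1..4*(n+m)}.
            vinner (capp (n+m) (?F k i) (us i)) (Ceps n m ws wp \<epsilon> (capp (n+m) (?F k j) (us j)))))
     \<le> (\<Sum>i\<in>?I. complex_of_real (aF * cA) * vinner (us i) (Ceps n m ws wp \<epsilon> (us i))
          + complex_of_real (aF * cB * (vnorm (us i))\<^sup>2))"
    if h: "0 < \<epsilon> \<and> \<epsilon> < 1 \<and> (\<forall>i\<in>?I. us i \<in> (\<Inter>i'\<in>?I. \<Inter>j'\<in>?I. cdom (n+m) (?F i' j')))"
    for \<epsilon> us
  proof -
    have mem: "us i \<in> cdom (n+m) (?F k l)" if "i \<in> ?I" "k \<in> ?I" "l \<in> ?I" for i k l
      using h that by blast
    have c: "capp (n+m) (?F k l) (us i) = Ff k l (us i)" if "i \<in> ?I" "k \<in> ?I" "l \<in> ?I" for i k l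
      by (rule capp_Fop(2)[OF that(2,3) mem[OF that]])
    have J: "k \<in> ?I" if "k \<in> {1..4*(n+m)}" for k using that by simp
    have "(\<Sum>i\<in>?I. \<Sum>j\<in>?I.
          vinner (us i) (Ceps n m ws wp \<epsilon> (capp (n+m) (?F i j) (us j)))
        + vinner (capp (n+m) (?F j i) (us i)) (Ceps n m ws wp \<epsilon> (us j))
        + (\<Sum>k\<in>{1..4*(n+m)}.
            vinner (capp (n+m) (?F k i) (us i)) (Ceps n m ws wp \<epsilon> (capp (n+m) (?F k j) (us j)))))
      = (\<Sum>i\<in>?I. \<Sum>j\<in>?I.
          vinner (us i) (Ceps n m ws wp \<epsilon> (Ff i j (us j)))
        + vinner (Ff j i (us i)) (Ceps n m ws wp \<epsilon> (us j))
        + (\<Sum>k\<in>{1..4*(n+m)}. vinner (Ff k i (us i)) (Ceps n m ws wp \<epsilon> (Ff k j (us j)))))"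
      by (simp only: c J cong: sum.cong)
    also have "\<dots> \<le> (\<Sum>i\<in>?I. complex_of_real (aF * cA) * vinner (us i) (Ceps n m ws wp \<epsilon> (us i))
          + complex_of_real (aF * cB * (vnorm (us i))\<^sup>2))"
      using h by (intro form_inequality capp_Fop(1) mem) auto
    finally show ?thesis .
  qed
  have nn: "aF * cA \<ge> 0" "aF * cB \<ge> 0"
    using aF_nonneg cA_nonneg cB_nonneg by auto
  show ?thesis
    \<comment> \<open>The estimates hold for every positive epsilon, so the threshold 1 is an
      arbitrary choice.\<close>
    by (rule exI[of _ 1], rule conjI[OF zero_less_one], rule exI[of _ "aF * cA"], rule exI[of _ "aF * cB"],
        intro conjI nn dom allI impI) (rule bdd[THEN conjunct1] bdd[THEN conjunct2] form, assumption)+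
qed

end
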